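(* Let $D$ be an integral domain with quotient field $K$, let $\Theta$ be a pre-Jaffard family of $D$, let $\{T_\alpha\}$, $\{\Theta_\alpha\}$ be its derived sequence and the associated chain of subsets of $\Theta$, let $\alpha$ be an ordinal, and let $\Theta':=(\Theta\setminus\Theta_\alpha)\cup\{T_\alpha\}$. Then $\Theta'$ is stable-preserving; that is, for every stable semistar operation $\star$ on $D$ and every $D$-submodule $I$ of $K$, $I^\star=\bigcap_{T\in\Theta'}(IT)^\star$.
   Context: All rings are integral domains; "compact" means quasi-compact. Let $E$ be a domain with quotient field $K$. An overring of $E$ is a ring $T$ with $E\subseteq T\subseteq K$; $\mathrm{Over}(E)$ is the set of overrings. The Zariski topology on $\mathrm{Over}(E)$ has as subbasis of open sets the sets $\mathcal B(x_1,\dots,x_n)=\{T\mid x_1,\dots,x_n\in T\}$, $x_i\in K$. For an overring $T$ put $\sigma(T)=\{Q\cap E\mid Q\in\mathrm{Spec}(T)\}$. An overring is flat if it is a flat $E$-module. A family $\Theta$ of overrings of $E$ is: - complete if $I=\bigcap\{IT\mid T\in\Theta\}$ for every ideal $I$ of $E$; - independent if $\sigma(A)\cap\sigma(B)=\{(0)\}$ for all distinct $A,B\in\Theta$; - locally finite if every nonzero $x\in K$ is a nonunit in only finitely many members of $\Theta$. $\Theta$ is a Jaffard family of $E$ if: either $K\notin\Theta$ or $\Theta=\{K\}$; every $T\in\Theta$ is flat over $E$; $\Theta$ is complete, independent and locally finite. A Jaffard overring of $E$ is a member of some Jaffard family of $E$. $\Theta$ is a pre-Jaffard family of $E$ if: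 either $K\notin\Theta$ or $\Theta=\{K\}$; every $T\in\Theta$ is flat over $E$; $\Theta$ is complete, independent, and compact in the Zariski topology. Derived sequence of a pre-Jaffard family $\Theta$ of $D$: $T_0:=D$, $\Theta_0:=\Theta$. For $\alpha=\gamma+1$, $\Theta_\alpha:=\Theta_\gamma\setminus(\Theta_\gamma)_J$, where $(\Theta_\gamma)_J$ is the set of those members of $\Theta_\gamma$ that are Jaffard overrings of $T_\gamma$. For $\alpha$ a limit ordinal, $\Theta_\alpha:=\bigcap_{\beta<\alpha}\Theta_\beta$. In both cases $T_\alpha:=\bigcap\{S\mid S\in\Theta_\alpha\}$, with $T_\alpha:=K$ if $\Theta_\alpha=\emptyset$. Let $\mathbf F_D(K)$ be the set of $D$-submodules of $K$. A semistar operation on $D$ is a map $\star:\mathbf F_D(K)\to\mathbf F_D(K)$, $I\mapsto I^\star$, such that for all $I,J\in\mathbf F_D(K)$ and $x\in K$: $I\subseteq I^\star$; $I\subseteq J$ implies $I^\star\subseteq J^\star$; $(I^\star)^\star=I^\star$; $x\cdot I^\star=(xI)^\star$. It is stable if $(I\cap J)^\star=I^\star\cap J^\star$ for all $I,J$. *)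

theory Defs
  imports
    "HOL-Analysis.Analysis"
    "HOL-Algebra.Algebra"
    "HOL-Algebra.Free_Abelian_Groups"
    "HOL-Decision_Procs.Algebra_Aux"
begin

text \<open>The quotient field \<open>K\<close> is the type \<open>'a\<close> of class \<^class>\<open>field\<close>; as a ring object it is
  \<^const>\<open>cring_class_ops\<close>.  Domains with quotient field \<open>K\<close> and their overrings are
  subsets of \<open>'a\<close>.\<close>

definition ring_on :: "'a::field set \<Rightarrow> 'a ring" where
  "ring_on E = cring_class_ops\<lparr>carrier := E\<rparr>"

definition module_on :: "'a::field set \<Rightarrow> ('a, 'a) module" where
  "module_on S = ring.extend (ring_on S) (module.fields (*))"

definition domain_with_quotient_field :: "'a::field set \<Rightarrow> bool" where
  "domain_with_quotient_field D \<longleftrightarrow>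
     subring D cring_class_ops \<and> (\<forall>x. \<exists>a\<in>D. \<exists>b\<in>D - {0}. x = a / b)"

definition module_homs ::
    "('r, 'c) ring_scheme \<Rightarrow> ('r, 'm, 'd) module_scheme \<Rightarrow> ('r, 'n, 'e) module_scheme \<Rightarrow> ('m \<Rightarrow> 'n) set"
  where "module_homs R M N =
    {f \<in> hom (add_monoid M) (add_monoid N).
       \<forall>r\<in>carrier R. \<forall>x\<in>carrier M. f (r \<odot>\<^bsub>M\<^esub> x) = r \<odot>\<^bsub>N\<^esub> f x}"

definition tensor_relators ::
    "('r, 'c) ring_scheme \<Rightarrow> ('r, 'm, 'd) module_scheme \<Rightarrow> ('r, 't, 'e) module_scheme \<Rightarrow> ('m \<times> 't \<Rightarrow>\<^sub>0 int) set"
  where "tensor_relators R M T =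
      {frag_of (x \<oplus>\<^bsub>M\<^esub> y, t) - frag_of (x, t) - frag_of (y, t) | x y t.
         x \<in> carrier M \<and> y \<in> carrier M \<and> t \<in> carrier T}
    \<union> {frag_of (x, t \<oplus>\<^bsub>T\<^esub> u) - frag_of (x, t) - frag_of (x, u) | x t u.
         x \<in> carrier M \<and> t \<in> carrier T \<and> u \<in> carrier T}
    \<union> {frag_of (r \<odot>\<^bsub>M\<^esub> x, t) - frag_of (x, r \<odot>\<^bsub>T\<^esub> t) | r x t.
         r \<in> carrier R \<and> x \<in> carrier M \<and> t \<in> carrier T}"

definition tensor_kernel ::
    "('r, 'c) ring_scheme \<Rightarrow> ('r, 'm, 'd) module_scheme \<Rightarrow> ('r, 't, 'e) module_scheme \<Rightarrow> ('m \<times> 't \<Rightarrow>\<^sub>0 int) set"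
  where "tensor_kernel R M T =
    generate (free_Abelian_group (carrier M \<times> carrier T)) (tensor_relators R M T)"

text \<open>The underlying abelian group (written multiplicatively, as every quotient group in
  \<^theory>\<open>HOL-Algebra.Coset\<close>) of the tensor product of \<open>M\<close> and \<open>T\<close> over \<open>R\<close>.\<close>

definition tensor_product ::
    "('r, 'c) ring_scheme \<Rightarrow> ('r, 'm, 'd) module_scheme \<Rightarrow> ('r, 't, 'e) module_scheme \<Rightarrow>
     ('m \<times> 't \<Rightarrow>\<^sub>0 int) set monoid"
  where "tensor_product R M T =
    free_Abelian_group (carrier M \<times> carrier T) Mod tensor_kernel R M T"

text \<open>The map from the tensor product of \<open>M\<close> and \<open>T\<close> to that of \<open>N\<close> and \<open>T\<close> sending the class of
  \<open>(x, t)\<close> to the class of \<open>(f x, t)\<close>; all elements of a coset have the same image.\<close>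

definition tensor_map ::
    "('r, 'c) ring_scheme \<Rightarrow> ('r, 'n, 'd) module_scheme \<Rightarrow> ('r, 't, 'e) module_scheme \<Rightarrow> ('m \<Rightarrow> 'n) \<Rightarrow>
     ('m \<times> 't \<Rightarrow>\<^sub>0 int) set \<Rightarrow> ('n \<times> 't \<Rightarrow>\<^sub>0 int) set"
  where "tensor_map R N T f C =
    the_elem ((\<lambda>z. r_coset (free_Abelian_group (carrier N \<times> carrier T)) (tensor_kernel R N T)
                     (frag_extend (\<lambda>(x, t). frag_of (f x, t)) z)) ` C)"

text \<open>A definition cannot quantify over all types, so the test modules have carriers in the type
  \<open>(nat \<Rightarrow> 'r) set\<close>.  This is no restriction: the cosets of a submodule of the free module of
  finitely supported sequences over \<open>R\<close> live in this type, so every countably generated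
  \<open>R\<close>-module has an isomorphic copy there, and failure of injectivity of a tensored map
  involves only finitely many elements of the two modules.\<close>

definition flat_module :: "('r, 'c) ring_scheme \<Rightarrow> ('r, 't, 'e) module_scheme \<Rightarrow> bool" where
  "flat_module R T \<longleftrightarrow> module R T \<and>
     (\<forall>(M :: ('r, (nat \<Rightarrow> 'r) set) module) (N :: ('r, (nat \<Rightarrow> 'r) set) module) f.
        module R M \<longrightarrow> module R N \<longrightarrow> f \<in> module_homs R M N \<longrightarrow> inj_on f (carrier M) \<longrightarrow>
        inj_on (tensor_map R N T f) (carrier (tensor_product R M T)))"

definition overrings :: "'a::field set \<Rightarrow> 'a set set" where
  "overrings E = {T. subring T cring_class_ops \<and> E \<subseteq> T}"

definition zariski :: "'a::field set \<Rightarrow> 'a set topology" where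
  "zariski E = topology_generated_by {{T \<in> overrings E. F \<subseteq> T} | F. finite F}"

definition contracted_primes :: "'a::field set \<Rightarrow> 'a set \<Rightarrow> 'a set set" where
  "contracted_primes E T = {Q \<inter> E | Q. primeideal Q (ring_on T)}"

text \<open>This is the product \<open>I T\<close>: \<^const>\<open>ideal_prod\<close> is the set of all finite sums of products, for
  arbitrary subsets of a ring.\<close>

abbreviation extend_to :: "'a::field set \<Rightarrow> 'a set \<Rightarrow> 'a set" where
  "extend_to I T \<equiv> ideal_prod cring_class_ops I T"

definition flat_overring :: "'a::field set \<Rightarrow> 'a set \<Rightarrow> bool" where
  "flat_overring E T \<longleftrightarrow> T \<in> overrings E \<and> flat_module (ring_on E) (module_on T)"

definition complete_family :: "'a::field set \<Rightarrow> 'a set set \<Rightarrow> bool" where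
  "complete_family E \<Theta> \<longleftrightarrow> (\<forall>I. ideal I (ring_on E) \<longrightarrow> I = (\<Inter>T\<in>\<Theta>. extend_to I T))"

definition independent_family :: "'a::field set \<Rightarrow> 'a set set \<Rightarrow> bool" where
  "independent_family E \<Theta> \<longleftrightarrow>
     (\<forall>A\<in>\<Theta>. \<forall>B\<in>\<Theta>. A \<noteq> B \<longrightarrow> contracted_primes E A \<inter> contracted_primes E B = {{0}})"

text \<open>Elements outside \<open>T\<close> count as nonunits of \<open>T\<close>.  Not counting them gives the same notion
  for overrings of a domain with quotient field \<open>K\<close>, as one sees by writing \<open>x\<close> as a quotient.\<close>

definition locally_finite_family :: "'a::field set set \<Rightarrow> bool" where
  "locally_finite_family \<Theta> \<longleftrightarrow> (\<forall>x. x \<noteq> 0 \<longrightarrow> finite {T \<in> \<Theta>. x \<notin> Units (ring_on T)})"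

definition jaffard_family :: "'a::field set \<Rightarrow> 'a set set \<Rightarrow> bool" where
  "jaffard_family E \<Theta> \<longleftrightarrow>
     \<Theta> \<subseteq> overrings E \<and> (UNIV \<notin> \<Theta> \<or> \<Theta> = {UNIV}) \<and> (\<forall>T\<in>\<Theta>. flat_overring E T) \<and>
     complete_family E \<Theta> \<and> independent_family E \<Theta> \<and> locally_finite_family \<Theta>"

definition jaffard_overring :: "'a::field set \<Rightarrow> 'a set \<Rightarrow> bool" where
  "jaffard_overring E T \<longleftrightarrow> (\<exists>\<Theta>. jaffard_family E \<Theta> \<and> T \<in> \<Theta>)"

definition pre_jaffard_family :: "'a::field set \<Rightarrow> 'a set set \<Rightarrow> bool" where
  "pre_jaffard_family E \<Theta> \<longleftrightarrow>
     \<Theta> \<subseteq> overrings E \<and> (UNIV \<notin> \<Theta> \<or> \<Theta> = {UNIV}) \<and> (\<forall>T\<in>\<Theta>. flat_overring E T) \<and>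
     complete_family E \<Theta> \<and> independent_family E \<Theta> \<and> compactin (zariski E) \<Theta>"

text \<open>Ordinals are elements of an arbitrary type of class \<^class>\<open>wellorder\<close>, an element standing
  for the order type of its set of predecessors.\<close>

definition ord_zero :: "'o::wellorder \<Rightarrow> bool" where
  "ord_zero \<alpha> \<longleftrightarrow> (\<forall>\<beta>. \<alpha> \<le> \<beta>)"

definition ord_succ :: "'o::wellorder \<Rightarrow> 'o \<Rightarrow> bool" where
  "ord_succ \<gamma> \<alpha> \<longleftrightarrow> \<gamma> < \<alpha> \<and> (\<forall>\<beta>. \<gamma> < \<beta> \<longrightarrow> \<alpha> \<le> \<beta>)"

text \<open>The empty intersection is \<open>UNIV\<close>, i.e. \<open>K\<close>, as required when \<open>F\<close> is empty.\<close>

definition stage_ring :: "'a::field set \<Rightarrow> 'o::wellorder \<Rightarrow> 'a set set \<Rightarrow> 'a set" where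
  "stage_ring D \<alpha> F = (if ord_zero \<alpha> then D else \<Inter>F)"

function derived_family :: "'a::field set \<Rightarrow> 'a set set \<Rightarrow> 'o::wellorder \<Rightarrow> 'a set set" where
  "derived_family D \<Theta> \<alpha> =
    (if ord_zero \<alpha> then \<Theta>
     else if \<exists>\<gamma>. ord_succ \<gamma> \<alpha> then
       (let F = derived_family D \<Theta> (THE \<gamma>. ord_succ \<gamma> \<alpha>) in
        F - {S \<in> F. jaffard_overring (stage_ring D (THE \<gamma>. ord_succ \<gamma> \<alpha>) F) S})
     else (\<Inter>\<beta>\<in>{..<\<alpha>}. derived_family D \<Theta> \<beta>))"
  by pat_completeness auto

lemma the_ord_succ:
  assumes "ord_succ \<gamma> \<alpha>" shows "(THE \<gamma>. ord_succ \<gamma> \<alpha>) = \<gamma>"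
  using assms unfolding ord_succ_def
  by (intro the_equality) (auto, meson leD linorder_neqE)

termination derived_family
proof (relation "inv_image {(x, y). x < y} (\<lambda>(D, \<Theta>, \<alpha>). \<alpha>)", goal_cases)
  case 1
  show ?case by (intro wf_inv_image wf)
next
  case (2 D \<Theta> \<alpha>)
  then show ?case by (auto simp: the_ord_succ) (auto simp: ord_succ_def)
qed auto

declare derived_family.simps [simp del]

definition derived_ring :: "'a::field set \<Rightarrow> 'a set set \<Rightarrow> 'o::wellorder \<Rightarrow> 'a set" where
  "derived_ring D \<Theta> \<alpha> = stage_ring D \<alpha> (derived_family D \<Theta> \<alpha>)"

lemma derived_zero:
  assumes "ord_zero \<alpha>"
  shows "derived_family D \<Theta> \<alpha> = \<Theta>" "derived_ring D \<Theta> \<alpha> = D"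
  using assms by (auto simp: derived_family.simps derived_ring_def stage_ring_def)

lemma derived_family_succ:
  assumes "ord_succ \<gamma> \<alpha>"
  shows "derived_family D \<Theta> \<alpha> =
    derived_family D \<Theta> \<gamma> -
      {S \<in> derived_family D \<Theta> \<gamma>. jaffard_overring (derived_ring D \<Theta> \<gamma>) S}"
proof -
  have "\<not> ord_zero \<alpha>" using assms by (auto simp: ord_zero_def ord_succ_def not_le)
  then show ?thesis
    using assms
    by (subst derived_family.simps) (auto simp: the_ord_succ derived_ring_def Let_def)
qed

lemma derived_family_limit:
  assumes "\<not> ord_zero \<alpha>" "\<nexists>\<gamma>. ord_succ \<gamma> \<alpha>"
  shows "derived_family D \<Theta> \<alpha> = (\<Inter>\<beta>\<in>{..<\<alpha>}. derived_family D \<Theta> \<beta>)"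
  using assms by (subst derived_family.simps) simp

lemma derived_ring_nonzero:
  "\<not> ord_zero \<alpha> \<Longrightarrow> derived_ring D \<Theta> \<alpha> = \<Inter>(derived_family D \<Theta> \<alpha>)"
  by (simp add: derived_ring_def stage_ring_def)

definition submodules_of_field :: "'a::field set \<Rightarrow> 'a set set" where
  "submodules_of_field D = {I. submodule I (ring_on D) (module_on UNIV)}"

definition semistar_operation :: "'a::field set \<Rightarrow> ('a set \<Rightarrow> 'a set) \<Rightarrow> bool" where
  "semistar_operation D star \<longleftrightarrow>
     (\<forall>I\<in>submodules_of_field D. star I \<in> submodules_of_field D) \<and>
     (\<forall>I\<in>submodules_of_field D. I \<subseteq> star I) \<and>
     (\<forall>I\<in>submodules_of_field D. \<forall>J\<in>submodules_of_field D. I \<subseteq> J \<longrightarrow> star I \<subseteq> star J) \<and>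
     (\<forall>I\<in>submodules_of_field D. star (star I) = star I) \<and>
     (\<forall>I\<in>submodules_of_field D. \<forall>x. (*) x ` star I = star ((*) x ` I))"

definition stable_semistar_operation :: "'a::field set \<Rightarrow> ('a set \<Rightarrow> 'a set) \<Rightarrow> bool" where
  "stable_semistar_operation D star \<longleftrightarrow>
     semistar_operation D star \<and>
     (\<forall>I\<in>submodules_of_field D. \<forall>J\<in>submodules_of_field D. star (I \<inter> J) = star I \<inter> star J)"

definition stable_preserving :: "'a::field set \<Rightarrow> 'a set set \<Rightarrow> bool" where
  "stable_preserving D \<Theta> \<longleftrightarrow>
     (\<forall>star. stable_semistar_operation D star \<longrightarrow>
        (\<forall>I\<in>submodules_of_field D. star I = (\<Inter>T\<in>\<Theta>. star (extend_to I T))))"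

end

theory Submission
  imports Defs
begin

text \<open>For \<open>x\<close> in every \<open>(IT)\<^sup>\<star>\<close> with \<open>T \<in> \<Theta>'\<close>, put \<open>N = x\<inverse>I\<^sup>\<star>\<close>, so that \<open>N\<^sup>\<star> = N\<close>, \<open>1 \<in> (NT)\<^sup>\<star>\<close> and
  the claim is \<open>1 \<in> N\<close>. By transfinite induction \<open>(N \<inter> D)T = T\<close> for every \<open>T \<in> \<Theta> \<setminus> \<Theta>\<^sub>\<beta>\<close>,
  \<open>\<beta> \<le> \<alpha>\<close>. Only successor stages need work: put \<open>E = T\<^sub>\<gamma>\<close>. Completeness of \<open>\<Theta>\<close> over \<open>D\<close> and flatness
  give \<open>NE \<inter> D = N \<inter> D\<close>, so \<open>J = ((N \<inter> D)E)\<^sup>\<star> \<inter> E\<close> is a closed ideal of \<open>E\<close> contracting to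
  \<open>N \<inter> D\<close>, and it suffices that \<open>JT = T\<close> for a Jaffard overring \<open>T\<close> of \<open>E\<close>. If \<open>0 \<noteq> j \<in> J\<close>
  and \<open>T\<close> lies in the Jaffard family \<open>\<Lambda>\<close>, then the ideal \<open>L\<close> of those elements of \<open>E\<close> that lie in
  \<open>jA\<close> for all \<open>A \<in> \<Lambda> \<setminus> {T}\<close> is essentially a finite intersection, so \<open>LT = T\<close> because \<open>AT = K\<close>; and
  \<open>L(JT \<inter> E) \<subseteq> J\<close> by completeness of \<open>\<Lambda>\<close>, so \<open>1 \<in> (JT \<inter> E)\<^sup>\<star>\<close> forces \<open>L \<subseteq> J\<close>.
  At the end, \<open>1 \<in> (NT\<^sub>\<alpha>)\<^sup>\<star> \<inter> D\<^sup>\<star> = (NT\<^sub>\<alpha> \<inter> D)\<^sup>\<star> \<subseteq> N\<^sup>\<star> = N\<close>.\<close>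

section \<open>Subrings and submodules of a field\<close>

text \<open>Submodules of \<open>K\<close> over \<open>E\<close>, stripped of the record structure,
  so that one module can be viewed over \<open>D\<close>, over \<open>E\<close> and over an overring
  \<open>T\<close> at once. Negatives are left out: they come from
  \<open>-1 \<in> E\<close>.\<close>

definition module_over :: "'a::field set \<Rightarrow> 'a set \<Rightarrow> bool" where
  "module_over E I \<longleftrightarrow> 0 \<in> I \<and> (\<forall>x\<in>I. \<forall>y\<in>I. x + y \<in> I) \<and> (\<forall>r\<in>E. \<forall>x\<in>I. r * x \<in> I)"

lemma module_overD:
  assumes "module_over E I"
  shows "0 \<in> I" "x \<in> I \<Longrightarrow> y \<in> I \<Longrightarrow> x + y \<in> I" "r \<in> E \<Longrightarrow> x \<in> I \<Longrightarrow> r * x \<in> I"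
  using assms by (auto simp: module_over_def)

abbreviation subring_of_field :: "'a::field set \<Rightarrow> bool" where
  "subring_of_field E \<equiv> subring E cring_class_ops"

lemma subring_of_fieldD:
  assumes "subring_of_field E"
  shows "1 \<in> E" "0 \<in> E" "x \<in> E \<Longrightarrow> - x \<in> E"
    "x \<in> E \<Longrightarrow> y \<in> E \<Longrightarrow> x * y \<in> E" "x \<in> E \<Longrightarrow> y \<in> E \<Longrightarrow> x + y \<in> E"
    "x \<in> E \<Longrightarrow> y \<in> E \<Longrightarrow> x - y \<in> E"
proof -
  note E = subringE[OF assms, unfolded class_simps]
  show "1 \<in> E" "0 \<in> E" "x \<in> E \<Longrightarrow> - x \<in> E" "x \<in> E \<Longrightarrow> y \<in> E \<Longrightarrow> x * y \<in> E"
    "x \<in> E \<Longrightarrow> y \<in> E \<Longrightarrow> x + y \<in> E"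
    using E(2,3,5-7) by auto
  show "x \<in> E \<Longrightarrow> y \<in> E \<Longrightarrow> x - y \<in> E"
    using E(5)[of y] E(7)[of x "- y"] by simp
qed

lemma subring_of_fieldI:
  fixes E :: "'a::field set"
  assumes "1 \<in> E" "\<And>x. x \<in> E \<Longrightarrow> - x \<in> E" "\<And>x y. x \<in> E \<Longrightarrow> y \<in> E \<Longrightarrow> x * y \<in> E"
    "\<And>x y. x \<in> E \<Longrightarrow> y \<in> E \<Longrightarrow> x + y \<in> E"
  shows "subring_of_field E"
  by (rule ring.subringI[OF cring.axioms(1)[OF cring_class]]) (use assms in \<open>auto simp: class_simps\<close>)

lemma module_over_uminus:
  assumes "subring_of_field E" "module_over E I" "x \<in> I"
  shows "- x \<in> I"
  using module_overD(3)[OF assms(2), of "-1" x] subring_of_fieldD[OF assms(1)] assms(3) by auto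

lemma module_over_diff:
  assumes "subring_of_field E" "module_over E I" "x \<in> I" "y \<in> I"
  shows "x - y \<in> I"
  using module_overD(2)[OF assms(2,3) module_over_uminus[OF assms(1,2,4)]] by simp

lemma ring_on_simps [simp]:
  "carrier (ring_on E) = E" "x \<otimes>\<^bsub>ring_on E\<^esub> y = x * y" "\<one>\<^bsub>ring_on E\<^esub> = 1"
  "\<zero>\<^bsub>ring_on E\<^esub> = 0" "x \<oplus>\<^bsub>ring_on E\<^esub> y = x + y"
  by (simp_all add: ring_on_def cring_class_ops_def)

lemma module_on_simps [simp]:
  "carrier (module_on E) = E" "x \<otimes>\<^bsub>module_on E\<^esub> y = x * y" "\<one>\<^bsub>module_on E\<^esub> = 1"
  "\<zero>\<^bsub>module_on E\<^esub> = 0" "x \<oplus>\<^bsub>module_on E\<^esub> y = x + y" "r \<odot>\<^bsub>module_on E\<^esub> x = r * x"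
  by (simp_all add: module_on_def ring.extend_def module.fields_def)

lemma cring_ring_on:
  assumes "subring_of_field E"
  shows "cring (ring_on E)"
proof (rule cringI)
  note E = subring_of_fieldD[OF assms]
  show "abelian_group (ring_on E)"
    by (rule abelian_groupI) (use E(2,3,5) in \<open>auto intro: bexI[of _ "- x" for x]\<close>)
  show "comm_monoid (ring_on E)"
    by (rule comm_monoidI) (use E in \<open>auto simp: algebra_simps\<close>)
qed (auto simp: algebra_simps)

lemma inv_add_monoid:
  assumes "subring_of_field E" "x \<in> E"
  shows "inv\<^bsub>add_monoid (ring_on E)\<^esub> x = - x" "inv\<^bsub>add_monoid (module_on E)\<^esub> x = - x"
proof -
  have "(THE y. y \<in> E \<and> x + y = 0 \<and> y + x = 0) = - x"
    by (rule the_equality) (use assms subring_of_fieldD(3)[OF assms(1)] minus_unique[of x] in auto)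
  then show "inv\<^bsub>add_monoid (ring_on E)\<^esub> x = - x" "inv\<^bsub>add_monoid (module_on E)\<^esub> x = - x"
    by (simp_all add: m_inv_def)
qed

lemma ideal_ring_on_iff:
  assumes "subring_of_field E"
  shows "ideal I (ring_on E) \<longleftrightarrow> I \<subseteq> E \<and> module_over E I"
proof
  assume "ideal I (ring_on E)"
  then interpret ideal I "ring_on E" .
  show "I \<subseteq> E \<and> module_over E I"
    unfolding module_over_def
    using a_subset additive_subgroup.zero_closed[OF is_additive_subgroup]
      additive_subgroup.a_closed[OF is_additive_subgroup] I_l_closed by simp
next
  assume I: "I \<subseteq> E \<and> module_over E I"
  interpret cring "ring_on E" by (rule cring_ring_on[OF assms])
  show "ideal I (ring_on E)"
  proof (rule idealI)
    show "subgroup I (add_monoid (ring_on E))"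
      by (rule add.subgroupI)
        (use I inv_add_monoid[OF assms] module_over_uminus[OF assms]
          module_overD[of E I] in \<open>auto simp: subset_iff a_inv_def\<close>)
    show "x \<otimes>\<^bsub>ring_on E\<^esub> a \<in> I" if "a \<in> I" "x \<in> carrier (ring_on E)" for a x
      using that I module_overD(3)[of E I] by auto
    then show "a \<otimes>\<^bsub>ring_on E\<^esub> x \<in> I" if "a \<in> I" "x \<in> carrier (ring_on E)" for a x
      using that by (auto simp: mult.commute)
  qed (rule ring_axioms)
qed

lemma submodules_of_field_iff:
  assumes "subring_of_field D"
  shows "I \<in> submodules_of_field D \<longleftrightarrow> module_over D I"
proof -
  have U: "subring_of_field (UNIV :: 'a set)" by (rule subring_of_fieldI) auto
  show ?thesis
  proof
    assume "I \<in> submodules_of_field D"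
    then interpret submodule I "ring_on D" "module_on UNIV"
      by (simp add: submodules_of_field_def)
    show "module_over D I"
      unfolding module_over_def
      using one_closed m_closed smult_closed by simp
  next
    assume I: "module_over D I"
    have "subgroup I (add_monoid (module_on UNIV))"
      by (rule subgroup.intro)
        (use inv_add_monoid[OF U] module_over_uminus[OF assms I] module_overD[OF I] in auto)
    then show "I \<in> submodules_of_field D"
      using module_overD[OF I]
      unfolding submodules_of_field_def
      by (auto intro!: submodule.intro submodule_axioms.intro)
  qed
qed

section \<open>Products \<open>I T\<close> inside \<open>K\<close>\<close>

lemma extend_to_prod: "i \<in> I \<Longrightarrow> t \<in> T \<Longrightarrow> i * t \<in> extend_to I T"
  using ideal_prod.prod[of i I t T cring_class_ops] by (simp add: class_simps)

lemma extend_to_sum: "x \<in> extend_to I T \<Longrightarrow> y \<in> extend_to I T \<Longrightarrow> x + y \<in> extend_to I T"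
  using ideal_prod.sum[of x cring_class_ops I T y] by (simp add: class_simps)

lemma extend_to_induct [consumes 1, case_names prod sum]:
  assumes "x \<in> extend_to I T"
    and "\<And>i t. i \<in> I \<Longrightarrow> t \<in> T \<Longrightarrow> P (i * t)"
    and "\<And>x y. x \<in> extend_to I T \<Longrightarrow> P x \<Longrightarrow> y \<in> extend_to I T \<Longrightarrow> P y \<Longrightarrow> P (x + y)"
  shows "P x"
  using assms(1) by induction (use assms(2,3) in \<open>auto simp: class_simps\<close>)

lemma extend_to_mono: "I \<subseteq> I' \<Longrightarrow> T \<subseteq> T' \<Longrightarrow> extend_to I T \<subseteq> extend_to I' T'"
  by (rule subsetI, erule extend_to_induct) (auto intro: extend_to_prod extend_to_sum)

lemma extend_to_subset: "subring_of_field T \<Longrightarrow> I \<subseteq> extend_to I T"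
  using extend_to_prod[of _ I 1 T] subring_of_fieldD(1) by fastforce

lemma extend_to_least:
  assumes "module_over T N" "I \<subseteq> N"
  shows "extend_to I T \<subseteq> N"
proof
  show "x \<in> N" if "x \<in> extend_to I T" for x
    using that
  proof (induction rule: extend_to_induct)
    case (prod i t)
    then show ?case
      using assms(2) module_overD(3)[OF assms(1), of t i] by (auto simp: mult.commute)
  qed (use module_overD(2)[OF assms(1)] in auto)
qed

lemma module_over_extend_to:
  assumes "subring_of_field T" "0 \<in> I"
  shows "module_over T (extend_to I T)"
proof -
  have "r * x \<in> extend_to I T" if "r \<in> T" "x \<in> extend_to I T" for r x
    using that(2)
  proof (induction rule: extend_to_induct)
    case (prod i t)
    then show ?case
      using extend_to_prod[of i I "r * t" T] subring_of_fieldD(4)[OF assms(1) that(1)]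
      by (simp add: ac_simps)
  qed (auto simp: distrib_left intro: extend_to_sum)
  then show ?thesis
    unfolding module_over_def
    using extend_to_sum extend_to_subset[OF assms(1), of I] assms(2) by auto
qed

lemma extend_to_scale:
  assumes "x \<in> extend_to I T" "\<And>i. i \<in> I \<Longrightarrow> c * i \<in> I'"
  shows "c * x \<in> extend_to I' T"
  using assms(1)
  by (induction rule: extend_to_induct)
    (auto simp: distrib_left mult.assoc[symmetric] intro: extend_to_prod extend_to_sum assms(2))

lemma module_over_subset: "module_over E I \<Longrightarrow> D \<subseteq> E \<Longrightarrow> module_over D I"
  by (auto simp: module_over_def)

lemma module_over_Int: "module_over E I \<Longrightarrow> module_over E J \<Longrightarrow> module_over E (I \<inter> J)"
  by (auto simp: module_over_def)

lemma module_over_self: "subring_of_field E \<Longrightarrow> module_over E E"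
  by (auto simp: module_over_def subring_of_fieldD)

lemma module_over_overring: "T \<in> overrings E \<Longrightarrow> module_over E T"
  by (auto simp: overrings_def intro: module_over_subset module_over_self)

lemma module_over_image:
  assumes "module_over E I"
  shows "module_over E ((*) c ` I)"
  unfolding module_over_def
proof (intro conjI ballI)
  show "0 \<in> (*) c ` I" using module_overD(1)[OF assms] by (force intro: image_eqI[of _ _ 0])
  show "x + y \<in> (*) c ` I" if "x \<in> (*) c ` I" "y \<in> (*) c ` I" for x y
    using that module_overD(2)[OF assms] by (auto simp: distrib_left[symmetric])
  show "r * x \<in> (*) c ` I" if "r \<in> E" "x \<in> (*) c ` I" for r x
    using that module_overD(3)[OF assms] by (auto simp: mult.left_commute)
qed

text \<open>The product \<open>C C'\<close> lies in \<open>C \<inter> C'\<close>, both being ideals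
  of \<open>E\<close>, so \<open>(C \<inter> C') T\<close> contains \<open>C C' T = T\<close>. This
  lets finitely many denominators be cleared at once.\<close>

lemma one_in_extend_Int:
  assumes "subring_of_field T" "E \<subseteq> T" "module_over E C" "module_over E C'" "C \<subseteq> E" "C' \<subseteq> E"
    and C: "1 \<in> extend_to C T" and C': "1 \<in> extend_to C' T"
  shows "1 \<in> extend_to (C \<inter> C') T"
proof -
  have "c' \<in> extend_to (C \<inter> C') T" if "c' \<in> C'" for c'
  proof -
    have "c' * 1 \<in> extend_to (C \<inter> C') T"
    proof (rule extend_to_scale[OF C])
      show "c' * i \<in> C \<inter> C'" if "i \<in> C" for i
        using that \<open>c' \<in> C'\<close> assms(5,6) module_overD(3)[OF assms(3), of c' i]
          module_overD(3)[OF assms(4), of i c'] by (auto simp: mult.commute)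
    qed
    then show ?thesis by simp
  qed
  then have "extend_to C' T \<subseteq> extend_to (C \<inter> C') T"
    using module_over_extend_to[OF assms(1), of "C \<inter> C'"] module_overD(1) assms(3,4)
    by (intro extend_to_least) (auto dest: module_overD(1))
  with C' show ?thesis by auto
qed

section \<open>Flat overrings\<close>

lemma tensor_relators_closed:
  assumes "module R M" "module R T"
  shows "tensor_relators R M T \<subseteq> carrier (free_Abelian_group (carrier M \<times> carrier T))"
proof -
  interpret M: module R M by fact
  interpret T: module R T by fact
  show ?thesis
    unfolding tensor_relators_def
    by (auto dest!: subsetD[OF keys_diff])
qed

lemma subgroup_tensor_kernel:
  assumes "module R M" "module R T"
  shows "subgroup (tensor_kernel R M T) (free_Abelian_group (carrier M \<times> carrier T))"
  unfolding tensor_kernel_def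
  by (rule group.generate_is_subgroup[OF group_free_Abelian_group tensor_relators_closed[OF assms]])

lemma tensor_kernel_closed:
  assumes "module R M" "module R T"
  shows "0 \<in> tensor_kernel R M T"
    "x \<in> tensor_kernel R M T \<Longrightarrow> y \<in> tensor_kernel R M T \<Longrightarrow> x + y \<in> tensor_kernel R M T"
    "x \<in> tensor_kernel R M T \<Longrightarrow> - x \<in> tensor_kernel R M T"
    "x \<in> tensor_kernel R M T \<Longrightarrow> y \<in> tensor_kernel R M T \<Longrightarrow> x - y \<in> tensor_kernel R M T"
    "x \<in> tensor_kernel R M T \<Longrightarrow> x \<in> carrier (free_Abelian_group (carrier M \<times> carrier T))"
proof -
  interpret subgroup "tensor_kernel R M T" "free_Abelian_group (carrier M \<times> carrier T)"
    by (rule subgroup_tensor_kernel[OF assms])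
  show *: "0 \<in> tensor_kernel R M T"
    "x \<in> tensor_kernel R M T \<Longrightarrow> y \<in> tensor_kernel R M T \<Longrightarrow> x + y \<in> tensor_kernel R M T" for x y
    using one_closed m_closed[of x y] by auto
  show carr: "x \<in> carrier (free_Abelian_group (carrier M \<times> carrier T))"
    if "x \<in> tensor_kernel R M T" for x
    by (rule mem_carrier[OF that])
  show m: "- x \<in> tensor_kernel R M T" if "x \<in> tensor_kernel R M T" for x
    using m_inv_closed[OF that] carr[OF that] by simp
  show "x - y \<in> tensor_kernel R M T" if "x \<in> tensor_kernel R M T" "y \<in> tensor_kernel R M T"
    using *(2)[OF that(1) m[OF that(2)]] by simp
qed

lemma tensor_kernel_relator:
  "x \<in> tensor_relators R M T \<Longrightarrow> x \<in> tensor_kernel R M T"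
  unfolding tensor_kernel_def by (rule generate.incl)

text \<open>The homomorphism of free groups induced by \<open>f\<close> sends relators to relators,
  so it descends to the tensor products.\<close>

lemma frag_extend_tensor_kernel:
  assumes M: "module R M" and N: "module R N" and T: "module R T"
    and f: "f \<in> module_homs R M N" and z: "z \<in> tensor_kernel R M T"
  shows "frag_extend (\<lambda>(x, t). frag_of (f x, t)) z \<in> tensor_kernel R N T"
proof -
  let ?F = "frag_extend (\<lambda>(x, t). frag_of (f x, t))"
  have rel: "?F h \<in> tensor_kernel R N T" if "h \<in> tensor_relators R M T" for h
  proof -
    have fadd: "f (x \<oplus>\<^bsub>M\<^esub> y) = f x \<oplus>\<^bsub>N\<^esub> f y" and fc: "f x \<in> carrier N"
      and fs: "r \<in> carrier R \<Longrightarrow> f (r \<odot>\<^bsub>M\<^esub> x) = r \<odot>\<^bsub>N\<^esub> f x"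
      if "x \<in> carrier M" "y \<in> carrier M" for x y r
      using f that by (auto simp: module_homs_def hom_def)
    have "?F h \<in> tensor_relators R N T"
      using that unfolding tensor_relators_def
      by (auto simp: frag_extend_diff fadd fs) (use fc in blast)+
    then show ?thesis by (rule tensor_kernel_relator)
  qed
  from z show ?thesis
    unfolding tensor_kernel_def[of R M T]
  proof (induction rule: generate.induct)
    case (inv h)
    moreover from this have "h \<in> carrier (free_Abelian_group (carrier M \<times> carrier T))"
      using tensor_relators_closed[OF M T] by (rule subsetD[rotated])
    ultimately show ?case
      using rel[of h] tensor_kernel_closed(3)[OF N T] by (simp add: frag_extend_minus)
  next
    case (eng x y)
    then show ?case
      using tensor_kernel_closed(2)[OF N T] by (simp add: frag_extend_add)
  qed (simp_all add: rel tensor_kernel_closed(1)[OF N T])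
qed

text \<open>The whole coset of \<open>z\<close> has a single image, since one kernel is carried into
  the other; hence \<open>the_elem\<close> in \<open>tensor_map\<close> evaluates as expected on
  representatives.\<close>

lemma tensor_map_coset:
  assumes M: "module R M" and N: "module R N" and T: "module R T"
    and f: "f \<in> module_homs R M N"
    and z: "z \<in> carrier (free_Abelian_group (carrier M \<times> carrier T))"
  shows "tensor_map R N T f
      (tensor_kernel R M T #>\<^bsub>free_Abelian_group (carrier M \<times> carrier T)\<^esub> z) =
    tensor_kernel R N T #>\<^bsub>free_Abelian_group (carrier N \<times> carrier T)\<^esub>
      frag_extend (\<lambda>(x, t). frag_of (f x, t)) z"
proof -
  let ?F = "frag_extend (\<lambda>(x, t). frag_of (f x, t))"
  let ?KM = "tensor_kernel R M T" and ?KN = "tensor_kernel R N T"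
  let ?GM = "free_Abelian_group (carrier M \<times> carrier T)"
  let ?GN = "free_Abelian_group (carrier N \<times> carrier T)"
  have "?KN #>\<^bsub>?GN\<^esub> ?F (k + z) = ?KN #>\<^bsub>?GN\<^esub> ?F z" if "k \<in> ?KM" for k
  proof -
    have k: "?F k \<in> ?KN" by (rule frag_extend_tensor_kernel[OF M N T f that])
    have "?KN #>\<^bsub>?GN\<^esub> (?F k + ?F z) = ?KN #>\<^bsub>?GN\<^esub> ?F z"
      unfolding r_coset_def
    proof (auto, goal_cases)
      case (1 h)
      show ?case
        by (rule tensor_kernel_closed(2)[OF N T 1 k])
    next
      case (2 h)
      then show ?case
        using tensor_kernel_closed(4)[OF N T 2 k] by (intro bexI[of _ "h - ?F k"]) auto
    qed
    then show ?thesis by (simp add: frag_extend_add)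
  qed
  then have "(\<lambda>k. ?KN #>\<^bsub>?GN\<^esub> ?F (k + z)) ` ?KM = (\<lambda>_. ?KN #>\<^bsub>?GN\<^esub> ?F z) ` ?KM"
    by (rule image_cong[OF refl])
  moreover have "?KM #>\<^bsub>?GM\<^esub> z = (\<lambda>k. k + z) ` ?KM"
    by (auto simp: r_coset_def)
  moreover have "?KM \<noteq> {}"
    using tensor_kernel_closed(1)[OF M T] by blast
  ultimately have "(\<lambda>w. ?KN #>\<^bsub>?GN\<^esub> ?F w) ` (?KM #>\<^bsub>?GM\<^esub> z) = {?KN #>\<^bsub>?GN\<^esub> ?F z}"
    by (simp only: image_image image_constant_conv if_False)
  then show ?thesis
    by (simp add: tensor_map_def)
qed

text \<open>The cosets of \<open>z\<close> and of \<open>0\<close> have the same image under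
  \<open>tensor_map\<close>, so injectivity identifies them.\<close>

lemma flat_module_tensor_kernel:
  fixes M N :: "('r, (nat \<Rightarrow> 'r) set) module"
  assumes flat: "flat_module R T" and M: "module R M" and N: "module R N"
    and f: "f \<in> module_homs R M N" "inj_on f (carrier M)"
    and z: "z \<in> carrier (free_Abelian_group (carrier M \<times> carrier T))"
    and Fz: "frag_extend (\<lambda>(x, t). frag_of (f x, t)) z \<in> tensor_kernel R N T"
  shows "z \<in> tensor_kernel R M T"
proof -
  let ?KM = "tensor_kernel R M T" and ?KN = "tensor_kernel R N T"
  let ?GM = "free_Abelian_group (carrier M \<times> carrier T)"
  let ?GN = "free_Abelian_group (carrier N \<times> carrier T)"
  have T: "module R T" and inj: "inj_on (tensor_map R N T f) (carrier (tensor_product R M T))"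
    using flat M N f by (auto simp: flat_module_def)
  have 0: "0 \<in> carrier ?GM" by simp
  have carr: "?KM #>\<^bsub>?GM\<^esub> w \<in> carrier (tensor_product R M T)" if "w \<in> carrier ?GM" for w
    using that by (auto simp: tensor_product_def FactGroup_def RCOSETS_def)
  have "tensor_map R N T f (?KM #>\<^bsub>?GM\<^esub> z) = tensor_map R N T f (?KM #>\<^bsub>?GM\<^esub> 0)"
    unfolding tensor_map_coset[OF M N T f(1) z] tensor_map_coset[OF M N T f(1) 0]
    using group.coset_join2[OF group_free_Abelian_group _ subgroup_tensor_kernel[OF N T] Fz]
      group.coset_join2[OF group_free_Abelian_group _ subgroup_tensor_kernel[OF N T]
        tensor_kernel_closed(1)[OF N T]]
      tensor_kernel_closed(5)[OF N T Fz] by simp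
  then have "?KM #>\<^bsub>?GM\<^esub> z = ?KM #>\<^bsub>?GM\<^esub> 0"
    using inj carr[OF z] carr[OF 0] by (auto dest: inj_onD)
  then have "z \<in> ?KM #>\<^bsub>?GM\<^esub> 0"
    using tensor_kernel_closed(1)[OF M T] by (force simp: r_coset_def)
  then show ?thesis by (auto simp: r_coset_def)
qed

text \<open>A copy of a submodule of the field inside the type that \<^const>\<open>flat_module\<close> quantifies over;
  its ring multiplication is irrelevant.\<close>

definition test_module :: "'a::field set \<Rightarrow> ('a, (nat \<Rightarrow> 'a) set) module" where
  "test_module M = \<lparr>carrier = (\<lambda>x. {\<lambda>_. x}) ` M, monoid.mult = (\<lambda>A B. A), monoid.one = {\<lambda>_. 0},
     ring.zero = {\<lambda>_. 0}, ring.add = (\<lambda>A B. {\<lambda>n. x n + y n | x y. x \<in> A \<and> y \<in> B}),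
     module.smult = (\<lambda>r A. (\<lambda>x n. r * x n) ` A)\<rparr>"

lemma test_module_simps [simp]:
  "carrier (test_module M) = (\<lambda>x. {\<lambda>_. x}) ` M"
  "\<zero>\<^bsub>test_module M\<^esub> = {\<lambda>_. 0}"
  "{\<lambda>_. x} \<oplus>\<^bsub>test_module M\<^esub> {\<lambda>_. y} = {\<lambda>_. x + y}"
  "r \<odot>\<^bsub>test_module M\<^esub> {\<lambda>_. x} = {\<lambda>_. r * x}"
  by (auto simp: test_module_def)

lemma module_test_module:
  assumes E: "subring_of_field E" and M: "module_over E M"
  shows "module (ring_on E) (test_module M)"
proof (rule moduleI)
  show "abelian_group (test_module M)"
  proof (rule abelian_groupI)
    show "\<exists>y\<in>carrier (test_module M). y \<oplus>\<^bsub>test_module M\<^esub> x = \<zero>\<^bsub>test_module M\<^esub>"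
      if "x \<in> carrier (test_module M)" for x
    proof -
      from that obtain m where "m \<in> M" "x = {\<lambda>_. m}" by auto
      then show ?thesis
        using module_over_uminus[OF E M] by (auto intro!: bexI[of _ "- m"])
    qed
  qed (use module_overD(1,2)[OF M] in \<open>auto simp: add.assoc add.commute add.left_commute\<close>)
next
  have mem: "\<exists>m\<in>M. x = {\<lambda>_. m}" if "x \<in> carrier (test_module M)" for x
    using that by auto
  show "a \<odot>\<^bsub>test_module M\<^esub> x \<in> carrier (test_module M)"
    if "a \<in> carrier (ring_on E)" "x \<in> carrier (test_module M)" for a x
    using mem[OF that(2)] that(1) module_overD(3)[OF M, of a] by auto
  show "(a \<oplus>\<^bsub>ring_on E\<^esub> b) \<odot>\<^bsub>test_module M\<^esub> x =
      a \<odot>\<^bsub>test_module M\<^esub> x \<oplus>\<^bsub>test_module M\<^esub> b \<odot>\<^bsub>test_module M\<^esub> x"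
    if "x \<in> carrier (test_module M)" for a b x
    using mem[OF that] by (elim bexE) (simp add: distrib_right)
  show "(a \<otimes>\<^bsub>ring_on E\<^esub> b) \<odot>\<^bsub>test_module M\<^esub> x =
      a \<odot>\<^bsub>test_module M\<^esub> (b \<odot>\<^bsub>test_module M\<^esub> x)"
    if "x \<in> carrier (test_module M)" for a b x
    using mem[OF that] by (elim bexE) (simp add: mult.assoc)
  show "\<one>\<^bsub>ring_on E\<^esub> \<odot>\<^bsub>test_module M\<^esub> x = x"
    if "x \<in> carrier (test_module M)" for x
    using mem[OF that] by (elim bexE) simp
  show "a \<odot>\<^bsub>test_module M\<^esub> (x \<oplus>\<^bsub>test_module M\<^esub> y) =
      a \<odot>\<^bsub>test_module M\<^esub> x \<oplus>\<^bsub>test_module M\<^esub> a \<odot>\<^bsub>test_module M\<^esub> y"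
    if "x \<in> carrier (test_module M)" "y \<in> carrier (test_module M)" for a x y
    using mem[OF that(1)] mem[OF that(2)] by (elim bexE) (simp add: distrib_left)
qed (rule cring_ring_on[OF E])

text \<open>Let \<open>C\<close> be the conductor of \<open>t\<close> and \<open>M = E + Et\<close>. The tensors \<open>1 \<otimes> t\<close> and \<open>t \<otimes> 1\<close> agree over \<open>K\<close>,
  hence over \<open>M\<close> by flatness; \<open>r + st \<mapsto> s\<close> is well defined modulo \<open>C\<close>, and the induced map from
  \<open>M \<otimes> T\<close> to \<open>T / CT\<close> sends the difference of the two tensors to \<open>-1\<close>.\<close>

lemma flat_overring_conductor:
  assumes E: "subring_of_field E" and K: "domain_with_quotient_field E"
    and flat: "flat_overring E T" and t: "t \<in> T"
  shows "1 \<in> extend_to {c\<in>E. c * t \<in> E} T"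
proof -
  define C where "C = {c\<in>E. c * t \<in> E}"
  define M where "M = {r + s * t | r s. r \<in> E \<and> s \<in> E}"
  note ED = subring_of_fieldD[OF E]
  have T: "subring_of_field T" and ET: "E \<subseteq> T" and fl: "flat_module (ring_on E) (module_on T)"
    using flat by (auto simp: flat_overring_def overrings_def)
  note TD = subring_of_fieldD[OF T]
  have Tmod: "module (ring_on E) (module_on T)" using fl by (simp add: flat_module_def)
  have MO: "module_over E M"
    unfolding module_over_def M_def
  proof (intro conjI ballI; (elim CollectE exE conjE)?)
    show "0 \<in> {r + s * t |r s. r \<in> E \<and> s \<in> E}"
      using ED(2) by (auto intro!: exI[of _ 0])
    show "x + y \<in> {r + s * t |r s. r \<in> E \<and> s \<in> E}"
      if "x = r + s * t" "r \<in> E" "s \<in> E" "y = r' + s' * t" "r' \<in> E" "s' \<in> E" for x y r s r' s'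
      using that ED(5) by (intro CollectI exI[of _ "r + r'"] exI[of _ "s + s'"]) (auto simp: algebra_simps)
    show "e * x \<in> {r + s * t |r s. r \<in> E \<and> s \<in> E}"
      if "e \<in> E" "x = r + s * t" "r \<in> E" "s \<in> E" for x e r s
      using that ED(4) by (intro CollectI exI[of _ "e * r"] exI[of _ "e * s"]) (auto simp: algebra_simps)
  qed
  have oneM: "1 \<in> M" and tM: "t \<in> M"
    unfolding M_def using ED(1,2) by force+
  let ?M = "test_module M" and ?N = "test_module (UNIV :: 'a set)"
  let ?R = "ring_on E" and ?T = "module_on T"
  have M: "module ?R ?M" by (rule module_test_module[OF E MO])
  have N: "module ?R ?N" by (rule module_test_module[OF E]) (auto simp: module_over_def)
  have id: "(\<lambda>x. x) \<in> module_homs ?R ?M ?N" "inj_on (\<lambda>x. x) (carrier ?M)"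
    by (auto simp: module_homs_def hom_def)
  let ?z = "frag_of ({\<lambda>_::nat. 1}, t) - frag_of ({\<lambda>_::nat. t}, 1)"
  have "?z \<in> tensor_kernel ?R ?M ?T"
  proof (rule flat_module_tensor_kernel[OF fl M N id])
    show "?z \<in> carrier (free_Abelian_group (carrier ?M \<times> carrier ?T))"
      using oneM tM TD(1) t by (auto dest!: subsetD[OF keys_diff])
    \<comment> \<open>With \<open>t = a / b\<close> and \<open>u = 1 / b\<close>, over
      \<open>K\<close> one has \<open>1 \<otimes> t = b u \<otimes> t = u \<otimes> a = a u
      \<otimes> 1 = t \<otimes> 1\<close>.\<close>
    obtain a b where ab: "a \<in> E" "b \<in> E" "b \<noteq> 0" "t = a / b"
      using K by (auto simp: domain_with_quotient_field_def) blast
    define u where "u = 1 / b"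
    have smult_rel: "frag_of (r \<odot>\<^bsub>?N\<^esub> {\<lambda>_. x}, s) - frag_of ({\<lambda>_. x}, r \<odot>\<^bsub>?T\<^esub> s)
        \<in> tensor_kernel ?R ?N ?T" if "r \<in> E" "s \<in> T" for r s x
      by (rule tensor_kernel_relator) (unfold tensor_relators_def, rule UnI2, rule CollectI,
          rule exI[of _ r], rule exI[of _ "{\<lambda>_. x}"], rule exI[of _ s], use that in auto)
    have "frag_of ({\<lambda>_::nat. b * u}, t) - frag_of ({\<lambda>_. u}, b * t) -
        (frag_of ({\<lambda>_. a * u}, 1) - frag_of ({\<lambda>_. u}, a * 1)) \<in> tensor_kernel ?R ?N ?T"
      using tensor_kernel_closed(4)[OF N Tmod smult_rel[OF ab(2) t, of u] smult_rel[OF ab(1) TD(1), of u]]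
      by simp
    moreover have "b * u = 1" "b * t = a" "a * u = t"
      using ab by (auto simp: u_def)
    ultimately show "frag_extend (\<lambda>(x, t). frag_of (x, t)) ?z \<in> tensor_kernel ?R ?N ?T"
      by (simp add: frag_extend_diff)
  qed
  \<comment> \<open>A coefficient of \<open>t\<close> in \<open>m\<close>; two choices differ by an
    element of \<open>C\<close>.\<close>
  define s where "s m = (SOME s. s \<in> E \<and> m - s * t \<in> E)" for m
  have s: "s m \<in> E" "m - s m * t \<in> E" if "m \<in> M" for m
  proof -
    have "\<exists>s. s \<in> E \<and> m - s * t \<in> E"
      using that by (auto simp: M_def)
    from someI_ex[OF this] show "s m \<in> E" "m - s m * t \<in> E" by (auto simp: s_def)
  qed
  have C0: "0 \<in> C" using ED(2) by (simp add: C_def)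
  let ?X = "extend_to C T"
  have CT: "module_over T ?X" by (rule module_over_extend_to[OF T C0])
  note CTD = module_overD[OF CT] module_over_diff[OF T CT] module_over_uminus[OF T CT]
  have sC: "c \<in> C" if "c \<in> E" "c * t = x" "x \<in> E" for c x
    using that by (auto simp: C_def)
  \<comment> \<open>The target is the additive group of \<open>K\<close> rather than
    \<open>T / C T\<close>; vanishing in the quotient becomes membership in
    \<open>?X\<close>.\<close>
  let ?A = "add_monoid (ring_on (UNIV :: 'a set))"
  have U: "subring_of_field (UNIV :: 'a set)" by (rule subring_of_fieldI) auto
  interpret A: comm_group ?A
    by (rule abelian_group.a_comm_group[OF ring.is_abelian_group[OF cring.axioms(1)[OF cring_ring_on[OF U]]]])
  \<comment> \<open>\<open>the_elem m 0\<close> recovers the field element from its copy in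
    \<open>test_module M\<close>.\<close>
  let ?f = "\<lambda>(m, u). s (the_elem m 0) * u"
  have "?f \<in> carrier ?M \<times> T \<rightarrow> carrier ?A" by simp
  then obtain h where h: "h \<in> hom (free_Abelian_group (carrier ?M \<times> T)) ?A"
    and hf: "\<And>x. x \<in> carrier ?M \<times> T \<Longrightarrow> h (frag_of x) = ?f x"
    using A.free_Abelian_group_universal[of ?f "carrier ?M \<times> T"] by blast
  define F where "F = carrier (free_Abelian_group (carrier ?M \<times> T))"
  have FD: "x + y \<in> F" "x - y \<in> F" if "x \<in> F" "y \<in> F" for x y
    using that keys_diff[of x y] keys_add[of x y] by (auto simp: F_def)
  have F0: "0 \<in> F" by (simp add: F_def)
  have hadd: "h (x + y) = h x + h y" if "x \<in> F" "y \<in> F" for x y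
    using hom_mult[OF h] that by (simp add: F_def)
  have hdiff: "h (x - y) = h x - h y" if "x \<in> F" "y \<in> F" for x y
    using hadd[OF FD(2)[OF that] that(2)] by simp
  have h0: "h 0 = 0" using hdiff[OF F0 F0] by simp
  have hfrag: "h (frag_of ({\<lambda>_. m}, u)) = s m * u" if "m \<in> M" "u \<in> T" for m u
    using that by (subst hf) auto
  have frag: "frag_of ({\<lambda>_. m}, u) \<in> F" if "m \<in> M" "u \<in> T" for m u
    using that by (auto simp: F_def)
  note MD = module_overD[OF MO]
  \<comment> \<open>Additivity in the second argument is exact, while additivity of \<open>s\<close>
    and its linearity over \<open>E\<close> hold only up to \<open>C\<close>.\<close>
  have rel: "h k \<in> ?X" if k: "k \<in> tensor_relators ?R ?M ?T" for k
  proof -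
    consider (1) x y u where "x \<in> M" "y \<in> M" "u \<in> T"
        "k = frag_of ({\<lambda>_. x + y}, u) - frag_of ({\<lambda>_. x}, u) - frag_of ({\<lambda>_. y}, u)"
      | (2) x u v where "x \<in> M" "u \<in> T" "v \<in> T"
        "k = frag_of ({\<lambda>_. x}, u + v) - frag_of ({\<lambda>_. x}, u) - frag_of ({\<lambda>_. x}, v)"
      | (3) r x u where "r \<in> E" "x \<in> M" "u \<in> T"
        "k = frag_of ({\<lambda>_. r * x}, u) - frag_of ({\<lambda>_. x}, r * u)"
      using k by (auto simp: tensor_relators_def)
    then show ?thesis
    proof cases
      case 1
      have "(s (x + y) - s x - s y) * t = (x - s x * t) + (y - s y * t) - (x + y - s (x + y) * t)"
        by (simp add: algebra_simps)
      then have "s (x + y) - s x - s y \<in> C"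
        using ED(6)[OF ED(5)[OF s(2)[OF 1(1)] s(2)[OF 1(2)]] s(2)[OF MD(2)[OF 1(1,2)]]]
        by (rule sC[OF ED(6)[OF ED(6)[OF s(1)[OF MD(2)[OF 1(1,2)]] s(1)[OF 1(1)]] s(1)[OF 1(2)]]])
      then have "(s (x + y) - s x - s y) * u \<in> ?X"
        by (rule extend_to_prod) (rule 1)
      moreover have "h k = (s (x + y) - s x - s y) * u"
        unfolding 1(4) using 1(1-3) MD(2)
        by (simp add: hdiff hfrag frag FD(2) left_diff_distrib)
      ultimately show ?thesis by simp
    next
      case 2
      have "h k = 0"
        unfolding 2(4) using 2(1-3) TD(5)
        by (simp add: hdiff hfrag frag FD(2) distrib_left)
      then show ?thesis using CTD(1) by simp
    next
      case 3
      have "(s (r * x) - r * s x) * t = r * (x - s x * t) - (r * x - s (r * x) * t)"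
        by (simp add: algebra_simps)
      then have "s (r * x) - r * s x \<in> C"
        using ED(6)[OF ED(4)[OF 3(1) s(2)[OF 3(2)]] s(2)[OF MD(3)[OF 3(1,2)]]]
        by (rule sC[OF ED(6)[OF s(1)[OF MD(3)[OF 3(1,2)]] ED(4)[OF 3(1) s(1)[OF 3(2)]]]])
      then have "(s (r * x) - r * s x) * u \<in> ?X"
        by (rule extend_to_prod) (rule 3)
      moreover have "r * u \<in> T" using 3(1,3) TD(4) ET by auto
      then have "h k = (s (r * x) - r * s x) * u"
        unfolding 3(4) using 3(1-3) MD(3)
        by (simp add: hdiff hfrag frag FD(2) left_diff_distrib mult.assoc mult.left_commute)
      ultimately show ?thesis by simp
    qed
  qed
  have "tensor_relators ?R ?M ?T \<subseteq> F"
    using tensor_relators_closed[OF M Tmod] by (simp add: F_def)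
  then have rel_carr: "k \<in> F" if "k \<in> tensor_relators ?R ?M ?T" for k
    using that by (rule subsetD)
  have "h z \<in> ?X \<and> z \<in> F" if "z \<in> tensor_kernel ?R ?M ?T" for z
    using that unfolding tensor_kernel_def
  proof (induction rule: generate.induct)
    case (inv k)
    then have "h (- k) = - h k" using hdiff[OF F0 rel_carr] h0 by simp
    moreover have "- k \<in> F" using FD(2)[OF F0 rel_carr[OF inv]] by simp
    moreover have "inv\<^bsub>free_Abelian_group (carrier ?M \<times> carrier ?T)\<^esub> k = - k"
      using rel_carr[OF inv] by (intro inv_free_Abelian_group) (simp add: F_def)
    ultimately show ?case using rel[OF inv] CTD(5) by simp
  next
    case (eng x y)
    then show ?case using hadd[of x y] CTD(2) FD(1)[of x y] by simp
  qed (use rel rel_carr CTD(1) h0 F0 in simp_all)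
  from this[OF \<open>?z \<in> tensor_kernel ?R ?M ?T\<close>] have "h ?z \<in> ?X" by simp
  then have *: "s 1 * t - s t \<in> ?X"
    using oneM tM t TD(1) by (simp add: hdiff hfrag frag FD(2))
  \<comment> \<open>The conclusion comes from
    \<open>1 = s 1 * t - (s 1 * t - s t) - (s t - 1)\<close>, where all three terms lie in
    \<open>C T\<close>.\<close>
  have "s 1 * t = 1 - (1 - s 1 * t)" by simp
  then have "s 1 \<in> C" using ED(6)[OF ED(1) s(2)[OF oneM]] by (rule sC[OF s(1)[OF oneM]])
  then have s1: "s 1 * t \<in> ?X" by (rule extend_to_prod) (rule t)
  have "(s t - 1) * t = - (t - s t * t)" by (simp add: algebra_simps)
  then have "s t - 1 \<in> C" using ED(3)[OF s(2)[OF tM]] by (rule sC[OF ED(6)[OF s(1)[OF tM] ED(1)]])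
  then have "(s t - 1) * 1 \<in> ?X" by (rule extend_to_prod) (rule TD(1))
  from CTD(4)[OF CTD(4)[OF s1 *] this] have "1 \<in> ?X" by simp
  then show ?thesis by (simp add: C_def)
qed

text \<open>Write \<open>x\<close> as a finite sum of products \<open>n * t\<close>. The conductors
  of the factors \<open>t\<close> intersect in an ideal \<open>C\<close> of \<open>E\<close> with
  \<open>C T = T\<close> and \<open>C x \<subseteq> N\<close>. Intersecting further with the
  conductor of \<open>x\<close>, which is where \<open>x \<in> T\<close> enters, gives multipliers
  of \<open>x\<close> into \<open>N \<inter> E\<close> that still generate \<open>T\<close>.\<close>

lemma flat_overring_Int:
  assumes E: "subring_of_field E" and K: "domain_with_quotient_field E"
    and flat: "flat_overring E T" and N: "module_over E N"
    and x: "x \<in> extend_to N T" "x \<in> T"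
  shows "x \<in> extend_to (N \<inter> E) T"
proof -
  have T: "subring_of_field T" and ET: "E \<subseteq> T"
    using flat by (auto simp: flat_overring_def overrings_def)
  note ED = subring_of_fieldD[OF E]
  have cond: "module_over E {c\<in>E. c * t \<in> E}" for t
    using ED by (auto simp: module_over_def distrib_right mult.assoc)
  have "\<exists>C. C \<subseteq> E \<and> module_over E C \<and> 1 \<in> extend_to C T \<and> (\<forall>c\<in>C. c * x \<in> N)"
    using x(1)
  proof (induction rule: extend_to_induct)
    case (prod n t)
    then show ?case
      using flat_overring_conductor[OF E K flat prod(2)] cond[of t]
        module_overD(3)[OF N _ prod(1), of "c * t" for c]
      by (intro exI[of _ "{c\<in>E. c * t \<in> E}"]) (auto simp: mult.assoc mult.commute[of n])
  next
    case (sum x y)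
    then obtain C C' where
      "C \<subseteq> E" "module_over E C" "1 \<in> extend_to C T" "\<forall>c\<in>C. c * x \<in> N"
      "C' \<subseteq> E" "module_over E C'" "1 \<in> extend_to C' T" "\<forall>c\<in>C'. c * y \<in> N" by blast
    then show ?case
      using one_in_extend_Int[OF T ET, of C C'] module_over_Int[of E C C'] module_overD(2)[OF N]
      by (intro exI[of _ "C \<inter> C'"]) (auto simp: distrib_left)
  qed
  then obtain C where C: "C \<subseteq> E" "module_over E C" "1 \<in> extend_to C T" "\<forall>c\<in>C. c * x \<in> N"
    by blast
  have "1 \<in> extend_to (C \<inter> {c\<in>E. c * x \<in> E}) T"
    by (rule one_in_extend_Int[OF T ET C(2) cond C(1) _ C(3) flat_overring_conductor[OF E K flat x(2)]]) auto
  then have "x * 1 \<in> extend_to (N \<inter> E) T"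
    by (rule extend_to_scale) (use C(4) in \<open>auto simp: mult.commute\<close>)
  then show ?thesis by simp
qed

section \<open>Independence\<close>

lemma domain_with_quotient_fieldD:
  assumes "domain_with_quotient_field D"
  shows "subring_of_field D"
  using assms by (simp add: domain_with_quotient_field_def)

lemma domain_with_quotient_field_overring:
  assumes "domain_with_quotient_field D" "subring_of_field E" "D \<subseteq> E"
  shows "domain_with_quotient_field E"
  using assms unfolding domain_with_quotient_field_def by blast

lemma module_over_INT: "(\<And>A. A \<in> G \<Longrightarrow> module_over E (f A)) \<Longrightarrow> module_over E (\<Inter>A\<in>G. f A)"
  by (auto simp: module_over_def)

text \<open>\<open>1 / q \<notin> R\<close> makes \<open>q R\<close> a proper ideal, and Zorn's
  lemma supplies a maximal, hence prime, ideal above it.\<close>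

lemma exists_primeideal:
  assumes R: "subring_of_field R" and q: "q \<in> R" "q \<noteq> 0" "1 / q \<notin> R"
  obtains Q where "primeideal Q (ring_on R)" "q \<in> Q"
proof -
  interpret cring "ring_on R" by (rule cring_ring_on[OF R])
  note RD = subring_of_fieldD[OF R]
  define S where "S = {I. I \<subseteq> R \<and> module_over R I \<and> q \<in> I \<and> 1 \<notin> I}"
  have "(*) q ` R \<in> S"
    unfolding S_def
  proof (intro CollectI conjI)
    show "1 \<notin> (*) q ` R"
    proof
      assume "1 \<in> (*) q ` R"
      then obtain r where r: "r \<in> R" "1 = q * r" by blast
      then have "r = 1 / q" using q(2) by (simp add: field_simps)
      with r q(3) show False by simp
    qed
    show "q \<in> (*) q ` R" using RD(1) by force
  qed (use RD(4) q(1) module_over_image[OF module_over_self[OF R]] in auto)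
  then have "S \<noteq> {}" by blast
  have "\<exists>M\<in>S. \<forall>I\<in>S. M \<subseteq> I \<longrightarrow> I = M"
  proof (rule subset_Zorn_nonempty[OF \<open>S \<noteq> {}\<close>])
    fix \<C> assume \<C>: "\<C> \<noteq> {}" "subset.chain S \<C>"
    then have CS: "\<C> \<subseteq> S" and chain: "\<And>I J. I \<in> \<C> \<Longrightarrow> J \<in> \<C> \<Longrightarrow> I \<subseteq> J \<or> J \<subseteq> I"
      by (auto simp: subset_chain_def)
    have mo: "module_over R I" if "I \<in> \<C>" for I
      using CS that by (auto simp: S_def)
    have "module_over R (\<Union>\<C>)"
      unfolding module_over_def
    proof (intro conjI ballI)
      show "0 \<in> \<Union>\<C>" using \<C>(1) mo module_overD(1) by blast
      show "x + y \<in> \<Union>\<C>" if xy: "x \<in> \<Union>\<C>" "y \<in> \<Union>\<C>" for x y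
      proof -
        obtain I J where IJ: "I \<in> \<C>" "x \<in> I" "J \<in> \<C>" "y \<in> J" using xy by blast
        then show ?thesis
          using chain[OF IJ(1,3)] module_overD(2)[OF mo[OF IJ(1)], of x y]
            module_overD(2)[OF mo[OF IJ(3)], of x y] by blast
      qed
      show "r * x \<in> \<Union>\<C>" if "r \<in> R" "x \<in> \<Union>\<C>" for r x
        using that mo module_overD(3) by blast
    qed
    then show "\<Union>\<C> \<in> S" using CS \<C>(1) unfolding S_def by auto
  qed
  then obtain M where M: "M \<in> S" "\<And>I. I \<in> S \<Longrightarrow> M \<subseteq> I \<Longrightarrow> I = M" by blast
  have "maximalideal M (ring_on R)"
  proof (rule maximalidealI)
    show "ideal M (ring_on R)" using M(1) by (simp add: ideal_ring_on_iff[OF R] S_def)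
    show "carrier (ring_on R) \<noteq> M" using M(1) RD(1) by (auto simp: S_def)
    show "J = M \<or> J = carrier (ring_on R)" if J: "ideal J (ring_on R)" "M \<subseteq> J" for J
    proof (cases "1 \<in> J")
      case True
      have "J \<subseteq> R" "module_over R J" using J(1) by (auto simp: ideal_ring_on_iff[OF R])
      then have "J = R" using module_overD(3)[OF _ _ True] by fastforce
      then show ?thesis by simp
    next
      case False
      then have "J \<in> S" using J M(1) by (auto simp: S_def ideal_ring_on_iff[OF R])
      then show ?thesis using M(2) J(2) by blast
    qed
  qed
  then have "primeideal M (ring_on R)" by (rule maximalideal_prime)
  moreover have "q \<in> M" using M(1) by (simp add: S_def)
  ultimately show ?thesis by (rule that)
qed

lemma primeideal_Int_subring:
  assumes A: "subring_of_field A" and R: "subring_of_field R" "A \<subseteq> R"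
    and Q: "primeideal Q (ring_on R)"
  shows "primeideal (Q \<inter> A) (ring_on A)"
proof (rule primeidealI)
  interpret primeideal Q "ring_on R" by (rule Q)
  have Q': "Q \<subseteq> R" "module_over R Q"
    using is_ideal by (auto simp: ideal_ring_on_iff[OF R(1)])
  show "ideal (Q \<inter> A) (ring_on A)"
    using module_over_subset[OF Q'(2) R(2)] module_over_self[OF A]
    by (auto simp: ideal_ring_on_iff[OF A] intro: module_over_Int)
  show "cring (ring_on A)" by (rule cring_ring_on[OF A])
  show "carrier (ring_on A) \<noteq> Q \<inter> A"
  proof
    assume "carrier (ring_on A) = Q \<inter> A"
    then have "1 \<in> Q" using subring_of_fieldD(1)[OF A] by auto
    then have "R \<subseteq> Q" using module_overD(3)[OF Q'(2), of _ 1] by auto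
    then show False using I_notcarr Q'(1) by auto
  qed
  show "a \<in> Q \<inter> A \<or> b \<in> Q \<inter> A"
    if "a \<in> carrier (ring_on A)" "b \<in> carrier (ring_on A)" "a \<otimes>\<^bsub>ring_on A\<^esub> b \<in> Q \<inter> A" for a b
    using I_prime[of a b] that R(2) by auto
qed

lemma subring_extend_to:
  assumes A: "subring_of_field A" and T: "subring_of_field T"
  shows "subring_of_field (extend_to A T)"
proof (rule subring_of_fieldI)
  note AT = module_over_extend_to[OF T subring_of_fieldD(2)[OF A]]
  show "1 \<in> extend_to A T"
    using extend_to_subset[OF T, of A] subring_of_fieldD(1)[OF A] by blast
  show "- x \<in> extend_to A T" if "x \<in> extend_to A T" for x
    by (rule module_over_uminus[OF T AT that])
  show "x + y \<in> extend_to A T" if "x \<in> extend_to A T" "y \<in> extend_to A T" for x y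
    by (rule extend_to_sum[OF that])
  show "x * y \<in> extend_to A T" if x: "x \<in> extend_to A T" and y: "y \<in> extend_to A T" for x y
    using y
  proof (induction rule: extend_to_induct)
    case (prod a t)
    have "a * x \<in> extend_to A T"
      by (rule extend_to_scale[OF x]) (use prod subring_of_fieldD(4)[OF A] in blast)
    then have "t * (a * x) \<in> extend_to A T"
      by (rule module_overD(3)[OF AT prod(2)])
    moreover have "t * (a * x) = x * (a * t)" by (simp add: ac_simps)
    ultimately show ?case by simp
  next
    case (sum y z)
    then show ?case by (simp add: distrib_left extend_to_sum)
  qed
qed

text \<open>A nonzero prime ideal of the compositum would contract to a nonzero prime of \<open>E\<close> lying in
  both families of contracted primes, so the compositum is a field.\<close>

lemma extend_to_independent:
  assumes E: "domain_with_quotient_field E" and A: "A \<in> overrings E" and T: "T \<in> overrings E"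
    and indep: "contracted_primes E A \<inter> contracted_primes E T = {{0}}"
  shows "extend_to A T = UNIV"
proof (rule ccontr)
  have sA: "subring_of_field A" "E \<subseteq> A" and sT: "subring_of_field T" "E \<subseteq> T"
    using A T by (auto simp: overrings_def)
  define R where "R = extend_to A T"
  have R: "subring_of_field R" unfolding R_def by (rule subring_extend_to[OF sA(1) sT(1)])
  have AR: "A \<subseteq> R" unfolding R_def by (rule extend_to_subset[OF sT(1)])
  have TR: "T \<subseteq> R"
    unfolding R_def using extend_to_prod[OF subring_of_fieldD(1)[OF sA(1)], of _ T] by auto
  assume "extend_to A T \<noteq> UNIV"
  then obtain z where z: "z \<notin> R" by (auto simp: R_def)
  obtain p q where pq: "p \<in> E" "q \<in> E" "q \<noteq> 0" "z = p / q"
    using E by (auto simp: domain_with_quotient_field_def) blast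
  \<comment> \<open>The denominator of an element outside \<open>R\<close> is a nonunit of
    \<open>R\<close> lying in \<open>E\<close>, so a prime containing it has nonzero contraction to
    \<open>E\<close>.\<close>
  have "1 / q \<notin> R"
  proof
    assume "1 / q \<in> R"
    then have "p * (1 / q) \<in> R" using subring_of_fieldD(4)[OF R] pq(1) sA(2) AR by blast
    then show False using z pq(4) by simp
  qed
  moreover have "q \<in> R" using pq(2) sA(2) AR by blast
  ultimately obtain Q where Q: "primeideal Q (ring_on R)" "q \<in> Q"
    using exists_primeideal[OF R _ pq(3)] by blast
  have "Q \<inter> E = (Q \<inter> A) \<inter> E" "Q \<inter> E = (Q \<inter> T) \<inter> E" using sA(2) sT(2) by auto
  then have "Q \<inter> E \<in> contracted_primes E A \<inter> contracted_primes E T"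
    unfolding contracted_primes_def
    using primeideal_Int_subring[OF sA(1) R AR Q(1)] primeideal_Int_subring[OF sT(1) R TR Q(1)]
    by blast
  then show False using indep Q(2) pq(2,3) by auto
qed

section \<open>Stable semistar operations and Jaffard overrings\<close>

locale stable_star =
  fixes D :: "'a::field set" and star :: "'a set \<Rightarrow> 'a set"
  assumes domain: "domain_with_quotient_field D"
    and stable: "stable_semistar_operation D star"
begin

lemma subring: "subring_of_field D"
  by (rule domain_with_quotient_fieldD[OF domain])

lemma star_module: "module_over D I \<Longrightarrow> module_over D (star I)"
  and star_extensive: "module_over D I \<Longrightarrow> I \<subseteq> star I"
  and star_mono: "module_over D I \<Longrightarrow> module_over D J \<Longrightarrow> I \<subseteq> J \<Longrightarrow> star I \<subseteq> star J"
  and star_idem: "module_over D I \<Longrightarrow> star (star I) = star I"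
  and star_image: "module_over D I \<Longrightarrow> (*) x ` star I = star ((*) x ` I)"
  and star_Int: "module_over D I \<Longrightarrow> module_over D J \<Longrightarrow> star (I \<inter> J) = star I \<inter> star J"
  using stable
  by (simp_all add: stable_semistar_operation_def semistar_operation_def
      submodules_of_field_iff[OF subring])

lemma star_le: "module_over D I \<Longrightarrow> module_over D J \<Longrightarrow> I \<subseteq> star J \<Longrightarrow> star I \<subseteq> star J"
  using star_mono[of I "star J"] star_module[of J] star_idem[of J] by simp

lemma star_scale:
  assumes "module_over D I" "module_over D J" "x \<in> star I" "\<And>i. i \<in> I \<Longrightarrow> c * i \<in> J"
  shows "c * x \<in> star J"
proof -
  have "(*) c ` star I \<subseteq> star J"
    unfolding star_image[OF assms(1)]
    by (rule star_mono) (use assms(2,4) module_over_image[OF assms(1)] in auto)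
  then show ?thesis using assms(3) by blast
qed

text \<open>Homogeneity extends the scalars: for \<open>r \<in> E\<close>,
  \<open>r * star I = star (r * I)\<close> is contained in \<open>star I\<close>.\<close>

lemma star_module_overring:
  assumes "D \<subseteq> E" "module_over E I"
  shows "module_over E (star I)"
proof -
  have I: "module_over D I" by (rule module_over_subset[OF assms(2,1)])
  have "r * x \<in> star I" if "r \<in> E" "x \<in> star I" for r x
    by (rule star_scale[OF I I that(2)]) (rule module_overD(3)[OF assms(2) that(1)])
  then show ?thesis
    using module_overD[OF star_module[OF I]] by (simp add: module_over_def)
qed

text \<open>Stability enters here: \<open>d\<close> lies in \<open>star I\<close> and in
  \<open>J \<subseteq> star J\<close>, thus in the closure of the intersection.\<close>

lemma one_in_star_Int:
  assumes "module_over D I" "module_over D J" "d \<in> star I" "d \<in> J"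
  shows "d \<in> star (I \<inter> J)"
  using assms star_extensive[of J] by (auto simp: star_Int)

lemma module_extend_to:
  assumes "T \<in> overrings D" "0 \<in> I"
  shows "module_over D (extend_to I T)"
  using assms by (auto simp: overrings_def intro!: module_over_subset[OF module_over_extend_to])

text \<open>For \<open>J \<noteq> 0\<close> there is an ideal \<open>L\<close> of \<open>E\<close>
  with \<open>L T = T\<close> that multiplies \<open>J T \<inter> E\<close> into \<open>J\<close>.
  Since \<open>1 \<in> star (J T \<inter> E)\<close>, homogeneity gives
  \<open>L \<subseteq> star J \<inter> E \<subseteq> J\<close>, and \<open>J T\<close> contains
  \<open>L T = T\<close>.\<close>

lemma jaffard_overring_extend_to:
  assumes E: "E \<in> overrings D" and T: "jaffard_overring E T"
    and J: "J \<subseteq> E" "module_over E J" "star J \<inter> E \<subseteq> J"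
    and one: "1 \<in> star (extend_to J T)"
  shows "1 \<in> extend_to J T"
proof -
  have sE: "subring_of_field E" and DE: "D \<subseteq> E" using E by (auto simp: overrings_def)
  have K: "domain_with_quotient_field E"
    by (rule domain_with_quotient_field_overring[OF domain sE DE])
  note ED = subring_of_fieldD[OF sE]
  obtain \<Lambda> where \<Lambda>: "jaffard_family E \<Lambda>" "T \<in> \<Lambda>"
    using T by (auto simp: jaffard_overring_def)
  have over: "A \<in> overrings E" if "A \<in> \<Lambda>" for A
    using \<Lambda>(1) that by (auto simp: jaffard_family_def)
  then have ring: "subring_of_field A" and EA: "E \<subseteq> A" if "A \<in> \<Lambda>" for A
    using that by (auto simp: overrings_def)
  have flat: "flat_overring E T" and indep: "independent_family E \<Lambda>"
    and complete: "complete_family E \<Lambda>" and fin: "locally_finite_family \<Lambda>"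
    using \<Lambda> by (auto simp: jaffard_family_def)
  have sT: "subring_of_field T" and ET: "E \<subseteq> T" using ring EA \<Lambda>(2) by auto
  have JD: "module_over D J" by (rule module_over_subset[OF J(2) DE])
  have JT: "module_over T (extend_to J T)"
    by (rule module_over_extend_to[OF sT module_overD(1)[OF J(2)]])
  have JTE: "module_over E (extend_to J T \<inter> E)"
    by (intro module_over_Int module_over_subset[OF JT ET] module_over_self[OF sE])
  have JTD: "module_over D (extend_to J T \<inter> E)"
    by (rule module_over_subset[OF JTE DE])
  \<comment> \<open>Cutting down to \<open>E\<close> places the elements to be multiplied in every
    member of \<open>\<Lambda>\<close>, not only in \<open>T\<close>.\<close>
  have one': "1 \<in> star (extend_to J T \<inter> E)"
    using one_in_star_Int[OF _ _ one ED(1)] module_over_subset[OF JT] ET DE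
      module_over_subset[OF module_over_self[OF sE] DE] by blast
  show ?thesis
  proof (cases "J = {0}")
    case True
    \<comment> \<open>No nonzero \<open>j\<close> is available, but \<open>J T = 0\<close> puts
      \<open>1\<close> into \<open>star J \<inter> E\<close>, hence into \<open>J\<close>.\<close>
    have "extend_to J T \<subseteq> J"
      by (rule extend_to_least) (auto simp: True module_over_def)
    then have "star (extend_to J T \<inter> E) \<subseteq> star J"
      by (intro star_mono JTD JD) auto
    then have "1 \<in> J" using one' J(3) ED(1) by auto
    then show ?thesis using extend_to_subset[OF sT] by blast
  next
    case False
    then obtain j where j: "j \<in> J" "j \<noteq> 0" using module_overD(1)[OF J(2)] by blast
    \<comment> \<open>This set is finite by local finiteness. For
      \<open>A \<in> \<Lambda> - {T}\<close> outside \<open>F\<close>, \<open>j A = A\<close>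
      contains \<open>E\<close>, so \<open>L F\<close> lies in \<open>j A\<close> for every
      \<open>A \<noteq> T\<close> in \<open>\<Lambda>\<close>.\<close>
    define F where "F = {A \<in> \<Lambda> - {T}. j \<notin> Units (ring_on A)}"
    have "F \<subseteq> \<Lambda> - {T}" by (auto simp: F_def)
    define L where "L G = E \<inter> (\<Inter>A\<in>G. (*) j ` A)" for G
    have "finite F"
      using fin j(2) by (auto simp: F_def locally_finite_family_def intro: finite_subset[rotated])
    have L_module: "module_over E (L G)" if "G \<subseteq> \<Lambda>" for G
    proof -
      have "module_over E ((*) j ` A)" if "A \<in> G" for A
        using that \<open>G \<subseteq> \<Lambda>\<close> over by (intro module_over_image module_over_overring) blast
      then show ?thesis
        unfolding L_def by (intro module_over_Int module_over_self[OF sE] module_over_INT)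
    qed
    have "1 \<in> extend_to (L F) T"
      using \<open>finite F\<close> \<open>F \<subseteq> \<Lambda> - {T}\<close>
    proof (induction rule: finite_subset_induct')
      case empty
      show ?case using extend_to_subset[OF sT, of "L {}"] ED(1) by (auto simp: L_def)
    next
      case (insert A G)
      have A: "A \<in> \<Lambda>" "A \<noteq> T" and G: "G \<subseteq> \<Lambda>" using insert by auto
      \<comment> \<open>Independence gives \<open>A T = K\<close>, so \<open>1 / j \<in> A T\<close>
        and \<open>1 \<in> (j A) T\<close>; flatness of \<open>T\<close> then replaces
        \<open>j A\<close> by \<open>j A \<inter> E\<close>.\<close>
      have "extend_to A T = UNIV"
        using indep A \<Lambda>(2) by (intro extend_to_independent[OF K] over) (auto simp: independent_family_def)
      then have "1 / j \<in> extend_to A T" by simp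
      then have "j * (1 / j) \<in> extend_to ((*) j ` A) T" by (rule extend_to_scale) (rule imageI)
      then have "1 \<in> extend_to ((*) j ` A) T" using j(2) by simp
      moreover have jA: "module_over E ((*) j ` A)"
        by (intro module_over_image module_over_overring over A)
      ultimately have jAE: "1 \<in> extend_to ((*) j ` A \<inter> E) T"
        by (intro flat_overring_Int[OF sE K flat] subring_of_fieldD(1)[OF sT])
      have "1 \<in> extend_to (((*) j ` A \<inter> E) \<inter> L G) T"
        by (rule one_in_extend_Int[OF sT ET module_over_Int[OF jA module_over_self[OF sE]]
              L_module[OF G] _ _ jAE insert.IH])
          (auto simp: L_def)
      moreover have "((*) j ` A \<inter> E) \<inter> L G = L (insert A G)" by (auto simp: L_def)
      ultimately show ?case by simp
    qed
    moreover have "L F \<subseteq> J"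
    proof
      fix l assume l: "l \<in> L F"
      then have lE: "l \<in> E" by (simp add: L_def)
      have "l * y \<in> J" if y: "y \<in> extend_to J T \<inter> E" for y
      proof -
        \<comment> \<open>Completeness of \<open>\<Lambda>\<close> reduces
          \<open>l * y \<in> J\<close> to membership in every \<open>J A\<close>: at
          \<open>A = T\<close> from \<open>y \<in> J T\<close>, elsewhere because
          \<open>l = j * a\<close> with \<open>a \<in> A\<close> and
          \<open>a * y \<in> A\<close>.\<close>
        have "l * y \<in> extend_to J A" if A: "A \<in> \<Lambda>" for A
        proof (cases "A = T")
          case True
          then show ?thesis using module_overD(3)[OF JT] lE ET y by blast
        next
          case False
          have "l \<in> (*) j ` A"
          proof (cases "A \<in> F")
            case True
            then show ?thesis using l by (auto simp: L_def)
          next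
            case notF: False
            then have "j \<in> Units (ring_on A)" using A False by (simp add: F_def)
            then obtain i where "i \<in> A" "j * i = 1" by (auto simp: Units_def)
            then show ?thesis
              using subring_of_fieldD(4)[OF ring[OF A], of i l] lE EA[OF A]
              by (intro image_eqI[of _ _ "i * l"]) (auto simp flip: mult.assoc)
          qed
          then obtain a where a: "a \<in> A" "l = j * a" by blast
          have "a * y \<in> A" using subring_of_fieldD(4)[OF ring[OF A]] a(1) y EA[OF A] by blast
          then show ?thesis using extend_to_prod[OF j(1), of "a * y" A] by (simp add: a(2) mult.assoc)
        qed
        moreover have "J = (\<Inter>A\<in>\<Lambda>. extend_to J A)"
          using complete J by (simp add: complete_family_def ideal_ring_on_iff[OF sE])
        ultimately show ?thesis by blast
      qed
      from star_scale[OF JTD JD one' this] have "l \<in> star J" by simp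
      then show "l \<in> J" using J(3) lE by blast
    qed
    ultimately show ?thesis using extend_to_mono[of "L F" J T T] by blast
  qed
qed

section \<open>One stage of the derived sequence, with remaining family \<open>F\<close> and stage
  ring \<open>E\<close>\<close>

context
  fixes \<Theta> F E N
  assumes complete: "complete_family D \<Theta>" and flat: "\<And>T. T \<in> \<Theta> \<Longrightarrow> flat_overring D T"
    and F: "F \<subseteq> \<Theta>" and E: "E \<in> overrings D" "\<And>A. A \<in> F \<Longrightarrow> E \<subseteq> A"
    and N: "module_over D N" "star N \<subseteq> N"
    and one_outside: "\<And>T. T \<in> \<Theta> - F \<Longrightarrow> 1 \<in> extend_to (N \<inter> D) T"
begin

text \<open>Completeness allows a check in each \<open>T \<in> \<Theta>\<close> separately. For
  \<open>T \<in> F\<close>, \<open>N E \<subseteq> N T\<close> and flatness contracts to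
  \<open>(N \<inter> D) T\<close>; for the other \<open>T\<close> already
  \<open>(N \<inter> D) T = T\<close>.\<close>

lemma extend_to_stage_Int: "extend_to N E \<inter> D \<subseteq> N \<inter> D"
proof
  fix d assume d: "d \<in> extend_to N E \<inter> D"
  have ND: "module_over D (N \<inter> D)"
    by (rule module_over_Int[OF N(1) module_over_self[OF subring]])
  have "d \<in> extend_to (N \<inter> D) T" if T: "T \<in> \<Theta>" for T
  proof (cases "T \<in> F")
    case True
    have "T \<in> overrings D" using flat[OF T] by (simp add: flat_overring_def)
    then show ?thesis
      using d extend_to_mono[OF order_refl E(2)[OF True], of N]
      by (intro flat_overring_Int[OF subring domain flat[OF T] N(1)]) (auto simp: overrings_def)
  next
    case False
    have T': "subring_of_field T" "D \<subseteq> T"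
      using flat[OF T] by (auto simp: flat_overring_def overrings_def)
    have "d * 1 \<in> extend_to (N \<inter> D) T"
      using module_overD(3)[OF module_over_extend_to[OF T'(1) module_overD(1)[OF ND]]]
        one_outside d T T'(2) False by blast
    then show ?thesis by simp
  qed
  moreover have "N \<inter> D = (\<Inter>T\<in>\<Theta>. extend_to (N \<inter> D) T)"
    using complete ND by (simp add: complete_family_def ideal_ring_on_iff[OF subring])
  ultimately show "d \<in> N \<inter> D" by blast
qed

text \<open>The closure \<open>J\<close> of \<open>(N \<inter> D) E\<close> inside \<open>E\<close>
  meets the hypotheses of \<open>jaffard_overring_extend_to\<close>. From \<open>J T = T\<close>,
  flatness over \<open>D\<close> yields \<open>(J \<inter> D) T = T\<close>, and \<open>J\<close>
  contracts into \<open>N \<inter> D\<close>.\<close>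

lemma one_in_extend_to_jaffard:
  assumes T: "T \<in> F" "jaffard_overring E T" and one: "1 \<in> star (extend_to N T)"
  shows "1 \<in> extend_to (N \<inter> D) T"
proof -
  define J where "J = star (extend_to (N \<inter> D) E) \<inter> E"
  have sE: "subring_of_field E" and DE: "D \<subseteq> E" using E(1) by (auto simp: overrings_def)
  have TO: "flat_overring D T" using flat F T(1) by blast
  then have sT: "subring_of_field T" and DT: "D \<subseteq> T" and T': "T \<in> overrings D"
    by (auto simp: flat_overring_def overrings_def)
  have ND0: "0 \<in> N \<inter> D" using module_overD(1)[OF N(1)] subring_of_fieldD(2)[OF subring] by simp
  have XE: "module_over E (extend_to (N \<inter> D) E)" by (rule module_over_extend_to[OF sE ND0])
  have XD: "module_over D (extend_to (N \<inter> D) E)" by (rule module_over_subset[OF XE DE])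
  have JE: "module_over E J"
    unfolding J_def
    by (intro module_over_Int star_module_overring DE XE module_over_self[OF sE])
  have JD: "module_over D J" by (rule module_over_subset[OF JE DE])
  have NJ: "N \<inter> D \<subseteq> J"
    unfolding J_def using extend_to_subset[OF sE, of "N \<inter> D"] star_extensive[OF XD] DE by blast
  have NT: "module_over D (extend_to N T)"
    by (rule module_extend_to[OF T' module_overD(1)[OF N(1)]])
  \<comment> \<open>\<open>N\<close> itself need not lie in \<open>E\<close>, so \<open>N T\<close>
    is first cut down to \<open>T\<close>, where flatness allows \<open>N\<close> to be replaced by
    \<open>N \<inter> D \<subseteq> J\<close>.\<close>
  have "1 \<in> star (extend_to N T \<inter> T)"
    by (rule one_in_star_Int[OF NT module_over_overring[OF T'] one subring_of_fieldD(1)[OF sT]])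
  moreover have "star (extend_to N T \<inter> T) \<subseteq> star (extend_to J T)"
  proof (rule star_mono)
    show "extend_to N T \<inter> T \<subseteq> extend_to J T"
      using flat_overring_Int[OF subring domain TO N(1)] extend_to_mono[OF NJ order_refl, of T]
      by blast
    show "module_over D (extend_to N T \<inter> T)"
      by (rule module_over_Int[OF NT module_over_overring[OF T']])
    show "module_over D (extend_to J T)"
      by (rule module_extend_to[OF T' module_overD(1)[OF JE]])
  qed
  ultimately have "1 \<in> star (extend_to J T)" by blast
  moreover have "star J \<inter> E \<subseteq> J"
    using star_le[OF JD XD] by (auto simp: J_def)
  ultimately have "1 \<in> extend_to J T"
    using jaffard_overring_extend_to[OF E(1) T(2) _ JE] by (auto simp: J_def)
  then have "1 \<in> extend_to (J \<inter> D) T"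
    by (rule flat_overring_Int[OF subring domain TO JD _ subring_of_fieldD(1)[OF sT]])
  \<comment> \<open>By stability \<open>d\<close> is in the closure of
    \<open>(N \<inter> D) E \<inter> D\<close>, which lies in
    \<open>N E \<inter> D \<subseteq> N\<close>; and \<open>N\<close> is closed.\<close>
  moreover have "J \<inter> D \<subseteq> N \<inter> D"
  proof
    fix d assume d: "d \<in> J \<inter> D"
    have "d \<in> star (extend_to (N \<inter> D) E \<inter> D)"
      by (rule one_in_star_Int[OF XD module_over_self[OF subring]]) (use d in \<open>auto simp: J_def\<close>)
    moreover have "star (extend_to (N \<inter> D) E \<inter> D) \<subseteq> star N"
      using extend_to_stage_Int extend_to_mono[of "N \<inter> D" N E E]
      by (intro star_mono module_over_Int XD module_over_self[OF subring] N(1)) blast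
    ultimately show "d \<in> N \<inter> D" using N(2) d by blast
  qed
  ultimately show ?thesis using extend_to_mono[of "J \<inter> D" "N \<inter> D" T T] by blast
qed

end

end

section \<open>The derived sequence\<close>

lemma derived_family_antimono:
  fixes \<alpha> \<beta> :: "'o::wellorder"
  assumes "\<beta> \<le> \<alpha>"
  shows "derived_family D \<Theta> \<alpha> \<subseteq> derived_family D \<Theta> \<beta>"
  using assms
proof (induction \<alpha> arbitrary: \<beta> rule: less_induct)
  case (less \<alpha>)
  show ?case
  proof (cases "\<beta> = \<alpha>")
    case False
    then have \<beta>: "\<beta> < \<alpha>" using less.prems by simp
    then have nz: "\<not> ord_zero \<alpha>" by (auto simp: ord_zero_def not_le)
    show ?thesis
    proof (cases "\<exists>\<gamma>. ord_succ \<gamma> \<alpha>")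
      case True
      then obtain \<gamma> where \<gamma>: "ord_succ \<gamma> \<alpha>" by blast
      then have "\<gamma> < \<alpha>" "\<beta> \<le> \<gamma>"
        using \<beta> by (auto simp: ord_succ_def not_le[symmetric])
      then show ?thesis using less.IH[of \<gamma> \<beta>] derived_family_succ[OF \<gamma>, of D \<Theta>] by blast
    next
      case False
      then show ?thesis using derived_family_limit[OF nz, of D \<Theta>] \<beta> by blast
    qed
  qed simp
qed

text \<open>The least element of the index type is stage zero, whose family is
  \<open>\<Theta>\<close>; the chain decreases from there.\<close>

lemma derived_family_subset: "derived_family D \<Theta> \<alpha> \<subseteq> \<Theta>"
proof -
  have z: "ord_zero (LEAST \<beta>::'b::wellorder. True)"
    unfolding ord_zero_def by (auto intro: Least_le)
  then show ?thesis
    using derived_family_antimono[of "LEAST \<beta>. True" \<alpha> D \<Theta>] derived_zero(1)[OF z, of D \<Theta>]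
    by (auto simp: ord_zero_def)
qed

lemma derived_ring_overring:
  assumes "subring_of_field D" "\<Theta> \<subseteq> overrings D"
  shows "derived_ring D \<Theta> \<alpha> \<in> overrings D"
    and "A \<in> derived_family D \<Theta> \<alpha> \<Longrightarrow> derived_ring D \<Theta> \<alpha> \<subseteq> A"
proof -
  have A: "subring_of_field A" "D \<subseteq> A" if "A \<in> derived_family D \<Theta> \<alpha>" for A
    using that assms(2) derived_family_subset[of D \<Theta> \<alpha>] by (auto simp: overrings_def)
  have "subring_of_field (\<Inter>(derived_family D \<Theta> \<alpha>))"
    by (rule subring_of_fieldI) (use subring_of_fieldD[OF A(1)] in blast)+
  then show "derived_ring D \<Theta> \<alpha> \<in> overrings D"
    using A(2) assms(1) by (auto simp: derived_ring_def stage_ring_def overrings_def)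
  show "A \<in> derived_family D \<Theta> \<alpha> \<Longrightarrow> derived_ring D \<Theta> \<alpha> \<subseteq> A"
    using A(2) by (auto simp: derived_ring_def stage_ring_def)
qed

text \<open>Transfinite induction on \<open>\<beta>\<close>; stage zero is vacuous. At a successor
  of \<open>\<gamma>\<close>, \<open>T\<close> either left before or is a Jaffard overring of the
  ring at \<open>\<gamma>\<close>; at a limit it left at some earlier stage. The bound
  \<open>\<beta> \<le> \<alpha>\<close> makes \<open>one\<close> applicable, because the families
  decrease.\<close>

lemma (in stable_star) one_in_extend_to_derived:
  fixes \<alpha> \<beta> :: "'o::wellorder"
  assumes \<Theta>: "pre_jaffard_family D \<Theta>" and N: "module_over D N" "star N \<subseteq> N"
    and one: "\<And>T. T \<in> \<Theta> - derived_family D \<Theta> \<alpha> \<Longrightarrow> 1 \<in> star (extend_to N T)"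
    and "\<beta> \<le> \<alpha>" "T \<in> \<Theta> - derived_family D \<Theta> \<beta>"
  shows "1 \<in> extend_to (N \<inter> D) T"
  using assms(5,6)
proof (induction \<beta> arbitrary: T rule: less_induct)
  case (less \<beta>)
  have nz: "\<not> ord_zero \<beta>" using less.prems(2) derived_zero(1)[of \<beta> D \<Theta>] by auto
  have \<Theta>': "\<Theta> \<subseteq> overrings D" "complete_family D \<Theta>" "\<And>T. T \<in> \<Theta> \<Longrightarrow> flat_overring D T"
    using \<Theta> by (auto simp: pre_jaffard_family_def)
  show ?case
  proof (cases "\<exists>\<gamma>. ord_succ \<gamma> \<beta>")
    case True
    then obtain \<gamma> where \<gamma>: "ord_succ \<gamma> \<beta>" by blast
    then have "\<gamma> < \<beta>" by (simp add: ord_succ_def)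
    then have IH: "1 \<in> extend_to (N \<inter> D) T" if "T \<in> \<Theta> - derived_family D \<Theta> \<gamma>" for T
      using less.IH[OF _ _ that] less.prems(1) by simp
    show ?thesis
    proof (cases "T \<in> derived_family D \<Theta> \<gamma>")
      case True
      then have "jaffard_overring (derived_ring D \<Theta> \<gamma>) T"
        using less.prems(2) derived_family_succ[OF \<gamma>, of D \<Theta>] by blast
      moreover have "1 \<in> star (extend_to N T)"
        using one less.prems derived_family_antimono[of \<beta> \<alpha> D \<Theta>] by blast
      ultimately show ?thesis
        using True derived_ring_overring[OF subring \<Theta>'(1)]
        by (intro one_in_extend_to_jaffard[OF \<Theta>'(2,3) derived_family_subset _ _ N IH])
    qed (use IH less.prems(2) in blast)
  next
    case False
    then obtain \<gamma> where "\<gamma> < \<beta>" "T \<in> \<Theta> - derived_family D \<Theta> \<gamma>"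
      using derived_family_limit[OF nz, of D \<Theta>] less.prems(2) by auto
    then show ?thesis using less.IH[of \<gamma> T] less.prems(1) by simp
  qed
qed

section \<open>Testing membership in \<open>star I\<close> on the members of
  \<open>\<Theta>'\<close>\<close>

theorem theorem7p5:
  fixes D :: "'a::field set" and \<Theta> :: "'a set set" and \<alpha> :: "'o::wellorder"
  assumes "domain_with_quotient_field D"
    and "pre_jaffard_family D \<Theta>"
  shows "stable_preserving D ((\<Theta> - derived_family D \<Theta> \<alpha>) \<union> {derived_ring D \<Theta> \<alpha>})"
  unfolding stable_preserving_def
proof (intro allI impI ballI)
  fix star I
  assume "stable_semistar_operation D star" and I': "I \<in> submodules_of_field D"
  then interpret stable_star D star by unfold_locales (use assms(1) in auto)
  have I: "module_over D I" using I' by (simp add: submodules_of_field_iff[OF subring])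
  let ?S = "derived_ring D \<Theta> \<alpha>" and ?F = "derived_family D \<Theta> \<alpha>"
  let ?\<Theta>' = "(\<Theta> - ?F) \<union> {?S}"
  have \<Theta>: "\<Theta> \<subseteq> overrings D" "complete_family D \<Theta>" "\<And>T. T \<in> \<Theta> \<Longrightarrow> flat_overring D T"
    using assms(2) by (auto simp: pre_jaffard_family_def)
  note S = derived_ring_overring[OF subring \<Theta>(1), where \<alpha> = \<alpha>]
  have over: "T \<in> overrings D" if "T \<in> ?\<Theta>'" for T
    using that \<Theta>(1) S(1) by blast
  have IT: "module_over D (extend_to I T)" if "T \<in> ?\<Theta>'" for T
    by (rule module_extend_to[OF over[OF that] module_overD(1)[OF I]])
  show "star I = (\<Inter>T\<in>?\<Theta>'. star (extend_to I T))"
  proof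
    show "star I \<subseteq> (\<Inter>T\<in>?\<Theta>'. star (extend_to I T))"
    proof (rule INT_greatest)
      fix T assume T: "T \<in> ?\<Theta>'"
      show "star I \<subseteq> star (extend_to I T)"
        using extend_to_subset over[OF T] by (intro star_mono I IT T) (auto simp: overrings_def)
    qed
    show "(\<Inter>T\<in>?\<Theta>'. star (extend_to I T)) \<subseteq> star I"
    proof
      fix x assume x: "x \<in> (\<Inter>T\<in>?\<Theta>'. star (extend_to I T))"
      show "x \<in> star I"
      proof (cases "x = 0")
        case True
        then show ?thesis using module_overD(1)[OF star_module[OF I]] by simp
      next
        case False
        \<comment> \<open>Dividing by \<open>x\<close> turns the goal into \<open>1 \<in> N\<close>;
          this normalisation is why \<open>x = 0\<close> is treated apart.\<close>
        define N where "N = (*) (1 / x) ` star I"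
        have N: "module_over D N"
          unfolding N_def by (rule module_over_image[OF star_module[OF I]])
        have NN: "star N \<subseteq> N"
          unfolding N_def star_image[OF star_module[OF I], symmetric] star_idem[OF I] ..
        have one: "1 \<in> star (extend_to N T)" if T: "T \<in> ?\<Theta>'" for T
        proof -
          have NT: "module_over D (extend_to N T)"
            by (rule module_extend_to[OF over[OF T] module_overD(1)[OF N]])
          have "x \<in> star (extend_to I T)" using x T by blast
          then have "1 / x * x \<in> star (extend_to N T)"
          proof (rule star_scale[OF IT[OF T] NT])
            show "1 / x * i \<in> extend_to N T" if "i \<in> extend_to I T" for i
              using star_extensive[OF I] by (intro extend_to_scale[OF that]) (auto simp: N_def)
          qed
          then show ?thesis using False by simp
        qed
        \<comment> \<open>The induction at \<open>\<beta> = \<alpha>\<close> disposes of the removed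
          members, so that \<open>?S\<close> can serve as the stage ring \<open>E\<close>.\<close>
        have "1 \<in> extend_to (N \<inter> D) T" if "T \<in> \<Theta> - ?F" for T
          by (rule one_in_extend_to_derived[OF assms(2) N NN one order_refl that]) blast
        then have *: "extend_to N ?S \<inter> D \<subseteq> N \<inter> D"
          by (intro extend_to_stage_Int[OF \<Theta>(2,3) derived_family_subset S N NN])
        have NS: "module_over D (extend_to N ?S)"
          by (rule module_extend_to[OF S(1) module_overD(1)[OF N]])
        \<comment> \<open>Here the membership for \<open>T = ?S\<close> is used: stability moves
          \<open>D\<close> inside the closure, where \<open>N ?S \<inter> D\<close> is contained in
          \<open>N\<close>.\<close>
        have "1 \<in> star (extend_to N ?S \<inter> D)"
          by (rule one_in_star_Int[OF NS module_over_self[OF subring] one subring_of_fieldD(1)[OF subring]]) simp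
        moreover have "star (extend_to N ?S \<inter> D) \<subseteq> star N"
          using * by (intro star_mono module_over_Int NS module_over_self[OF subring] N) blast
        ultimately have "1 \<in> N" using NN by blast
        then show ?thesis using False by (auto simp: N_def field_simps)
      qed
    qed
  qed
qed

end
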